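(* Let $n\ge 2$, write $n=2l+\epsilon$ with $\epsilon\in\{0,1\}$, and let $p_1,\dots,p_{n+3}\in\mathbb{P}^n$ be points in general position. For integers (or, in part (II), real numbers) $d,m_1,\dots,m_{n+3}$ set $M=\sum_{i=1}^{n+3}m_i$ and, for $I\subseteq\{1,\dots,n+3\}$ and an integer $t$, $$k_{I,\sigma_t}:=tM+\sum_{i\in I}m_i-\big((n+1)t+|I|-1\big)d .$$ Consider the conditions \begin{align*} (A_n)&\quad m_i\le d &&\text{for all } i=1,\dots,n+3,\\ (B_n)&\quad M-m_i\le nd &&\text{for all } i=1,\dots,n+3,\\ (C_{n,t})&\quad k_{I,\sigma_t}\le 0 &&\text{for all } I\subseteq\{1,\dots,n+3\}\text{ with }|I|=n-2t+1. \end{align*} (I) For integers $d\ge 0$ and $m_1,\dots,m_{n+3}\ge 0$, the linear system $\mathcal{L}_{n,d}(m_1,\dots,m_{n+3})$ is non-empty if and only if $(A_n)$, $(B_n)$ and $(C_{n,t})$ for all $1\le t\le l+\epsilon$ hold. (II) Let $X$ be the blow-up of $\mathbb{P}^n$ at $p_1,\dots,p_{n+3}$. The facets of the effective cone $\mathrm{Eff}_{\mathbb{R}}(X)\subset \mathrm{N}^1(X)_{\mathbb R}$ are given by the equalities in $(A_n)$, $(B_n)$, and $(C_{n,t})$ with $-1\le t\le l+\epsilon$. That is, $\mathrm{Eff}_{\mathbb{R}}(X)$ is the polyhedral cone defined by these inequalities in the coordinates $(d,m_1,\dots,m_{n+3})$, and its facets are the loci in it where one of these inequalities is an equality.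
   Context: $\mathbb{P}^n$ is projective space over $\mathbb{C}$. $\mathcal{L}_{n,d}(m_1,\dots,m_{n+3})$ is the linear system of degree-$d$ hypersurfaces of $\mathbb{P}^n$ having multiplicity at least $m_i$ at $p_i$ for each $i$. It is non-empty if it contains a hypersurface, i.e. if there is a nonzero homogeneous form of degree $d$ vanishing to order at least $m_i$ at each $p_i$. On $X$, let $H$ be the pullback of the hyperplane class and $E_i$ the exceptional divisor over $p_i$. The real Néron–Severi space $\mathrm{N}^1(X)_{\mathbb R}$ has coordinates $(d,m_1,\dots,m_{n+3})$, corresponding to the class $dH-\sum_{i=1}^{n+3}m_iE_i$ (the $m_i$ may be negative here). $\mathrm{Eff}_{\mathbb R}(X)$ is the cone generated by classes of effective divisors. The number $k_{I,\sigma_t}$ is defined purely by the displayed formula for all integers $t\geq -1$. For example, $(C_{n,-1})$ is the condition $d\ge 0$, and $(C_{n,0})$ says $\sum_{i\in I}m_i\le nd$ for all $|I|=n+1$. *)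

theory Defs
  imports "HOL-Analysis.Analysis" "HOL-Library.Poly_Mapping"
    "HOL-Computational_Algebra.Factorial_Ring"
begin

text \<open>
  Conventions.  The homogeneous coordinates of projective n-space are indexed by a finite type
  \<open>'v\<close> with n + 1 elements, and the points by a finite type \<open>'i\<close> with n + 3 elements; a point is
  given by a vector of homogeneous coordinates in \<open>complex ^ 'v\<close>.
\<close>

subsection \<open>Forms and multiplicities\<close>

type_synonym 'v mpoly = "('v \<Rightarrow>\<^sub>0 nat) \<Rightarrow>\<^sub>0 complex"

definition mdegree :: "('v::finite \<Rightarrow>\<^sub>0 nat) \<Rightarrow> nat" where
  "mdegree a = (\<Sum>j\<in>UNIV. Poly_Mapping.lookup a j)"

definition homogeneous :: "nat \<Rightarrow> 'v::finite mpoly \<Rightarrow> bool" where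
  "homogeneous d F \<longleftrightarrow> (\<forall>a\<in>Poly_Mapping.keys F. mdegree a = d)"

definition total_degree :: "'v::finite mpoly \<Rightarrow> nat" where
  "total_degree F = Max (mdegree ` Poly_Mapping.keys F)"

definition peval :: "'v::finite mpoly \<Rightarrow> complex ^ 'v \<Rightarrow> complex" where
  "peval F x = (\<Sum>a\<in>Poly_Mapping.keys F.
     Poly_Mapping.lookup F a * (\<Prod>j\<in>UNIV. (x $ j) ^ Poly_Mapping.lookup a j))"

text \<open>Formal partial derivative.  If \<open>j\<close> does not occur in the monomial \<open>a\<close>, the subtraction is
  truncated, but then the coefficient \<open>Poly_Mapping.lookup a j\<close> is 0.\<close>

definition pdiff :: "'v \<Rightarrow> 'v mpoly \<Rightarrow> 'v mpoly" where
  "pdiff j F = (\<Sum>a\<in>Poly_Mapping.keys F.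
     Poly_Mapping.single (a - Poly_Mapping.single j 1)
       (of_nat (Poly_Mapping.lookup a j) * Poly_Mapping.lookup F a))"

text \<open>For a form \<open>F\<close>, this does not depend on the choice of the homogeneous coordinate vector \<open>v\<close>
  of the point, and it agrees with vanishing to order at least \<open>k\<close> of a local equation of
  the hypersurface in an affine chart, because the affine cone over the hypersurface is near \<open>v\<close>
  a product of the hypersurface with a line.\<close>

definition vanishes_to_order :: "nat \<Rightarrow> 'v::finite mpoly \<Rightarrow> complex ^ 'v \<Rightarrow> bool" where
  "vanishes_to_order k F v \<longleftrightarrow> (\<forall>js. length js < k \<longrightarrow> peval (foldr pdiff js F) v = 0)"

text \<open>Only meaningful for \<open>F \<noteq> 0\<close>, where the order of vanishing is bounded by the degree.\<close>

definition multiplicity_at :: "'v::finite mpoly \<Rightarrow> complex ^ 'v \<Rightarrow> nat" where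
  "multiplicity_at F v = (GREATEST k. vanishes_to_order k F v)"

subsection \<open>Points in general position and linear systems\<close>

text \<open>General position is linearly general position: any n + 1 of the points span the whole
  projective space.\<close>

definition general_position :: "('i::finite \<Rightarrow> complex ^ 'v::finite) \<Rightarrow> bool" where
  "general_position p \<longleftrightarrow>
     (\<forall>S. card S = CARD('v) \<longrightarrow> inj_on p S \<and> vec.independent (p ` S))"

definition linear_system ::
    "('i \<Rightarrow> complex ^ 'v::finite) \<Rightarrow> nat \<Rightarrow> ('i \<Rightarrow> nat) \<Rightarrow> 'v mpoly set" where
  "linear_system p d m = {F. homogeneous d F \<and> (\<forall>i. vanishes_to_order (m i) F (p i))}"

text \<open>The linear system is a vector space of forms; a hypersurface in it is a nonzero form up to
  scalars.\<close>

definition linear_system_nonempty ::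
    "('i \<Rightarrow> complex ^ 'v::finite) \<Rightarrow> nat \<Rightarrow> ('i \<Rightarrow> nat) \<Rightarrow> bool" where
  "linear_system_nonempty p d m \<longleftrightarrow> (\<exists>F\<in>linear_system p d m. F \<noteq> 0)"

subsection \<open>Divisors on the blow-up\<close>

text \<open>
  The blow-down \<open>X \<rightarrow> P\<^sup>n\<close> is an isomorphism over the complement of the points.  So
  the prime divisors of X are the exceptional divisors \<open>E\<^sub>i\<close> and the strict transforms of the
  irreducible hypersurfaces of projective space.  An irreducible hypersurface is represented by an
  irreducible form defining it; forms that differ by a nonzero scalar represent the
  same prime divisor, which affects neither effectivity nor classes below.
\<close>

datatype ('i, 'v) prime_divisor = Exceptional 'i | Strict_Transform "'v mpoly"

definition prime_divisors :: "('i, 'v::finite) prime_divisor set" where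
  "prime_divisors =
     range Exceptional \<union> Strict_Transform ` {F. irreducible F \<and> (\<exists>d. homogeneous d F)}"

text \<open>
  The real Neron-Severi space with the coordinates \<open>(d, m)\<close> of the class
  \<open>d H - (\<Sum>i. m\<^sub>i E\<^sub>i)\<close>.
\<close>

type_synonym 'i N1 = "real \<times> (real ^ 'i)"

text \<open>
  The pullback of a degree-d hypersurface has class \<open>d H\<close>, and it is the sum of the strict
  transform and of the \<open>E\<^sub>i\<close> taken with the multiplicity of the hypersurface at \<open>p\<^sub>i\<close>.
  The class \<open>E\<^sub>i\<close> itself has coordinate \<open>m\<^sub>i = -1\<close>.
\<close>

fun prime_class ::
    "('i::finite \<Rightarrow> complex ^ 'v::finite) \<Rightarrow> ('i, 'v) prime_divisor \<Rightarrow> 'i N1" where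
  "prime_class p (Exceptional i) = (0, - axis i 1)"
| "prime_class p (Strict_Transform F) =
     (real (total_degree F), \<chi> i. real (multiplicity_at F (p i)))"

definition divisors :: "(('i, 'v::finite) prime_divisor \<Rightarrow>\<^sub>0 int) set" where
  "divisors = {D. Poly_Mapping.keys D \<subseteq> prime_divisors}"

definition effective :: "(('i, 'v::finite) prime_divisor \<Rightarrow>\<^sub>0 int) \<Rightarrow> bool" where
  "effective D \<longleftrightarrow> D \<in> divisors \<and> (\<forall>Z. Poly_Mapping.lookup D Z \<ge> 0)"

definition divisor_class ::
    "('i::finite \<Rightarrow> complex ^ 'v::finite) \<Rightarrow> (('i, 'v) prime_divisor \<Rightarrow>\<^sub>0 int) \<Rightarrow> 'i N1" where
  "divisor_class p D = (\<Sum>Z\<in>Poly_Mapping.keys D.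
     of_int (Poly_Mapping.lookup D Z) *\<^sub>R prime_class p Z)"

definition effective_cone :: "('i::finite \<Rightarrow> complex ^ 'v::finite) \<Rightarrow> 'i N1 set" where
  "effective_cone p = convex_cone hull {divisor_class p D | D. effective D}"

subsection \<open>The inequalities\<close>

definition k_sigma :: "nat \<Rightarrow> real \<Rightarrow> real ^ 'i \<Rightarrow> 'i::finite set \<Rightarrow> int \<Rightarrow> real" where
  "k_sigma n d m I t =
     of_int t * (\<Sum>i\<in>UNIV. m $ i) + (\<Sum>i\<in>I. m $ i)
       - ((real n + 1) * of_int t + real (card I) - 1) * d"

definition cond_A :: "real \<Rightarrow> real ^ 'i::finite \<Rightarrow> bool" where
  "cond_A d m \<longleftrightarrow> (\<forall>i. m $ i \<le> d)"

definition cond_B :: "nat \<Rightarrow> real \<Rightarrow> real ^ 'i::finite \<Rightarrow> bool" where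
  "cond_B n d m \<longleftrightarrow> (\<forall>i. (\<Sum>j\<in>UNIV. m $ j) - m $ i \<le> real n * d)"

definition cond_C :: "nat \<Rightarrow> int \<Rightarrow> real \<Rightarrow> real ^ 'i::finite \<Rightarrow> bool" where
  "cond_C n t d m \<longleftrightarrow>
     (\<forall>I. int (card I) = int n - 2 * t + 1 \<longrightarrow> k_sigma n d m I t \<le> 0)"

end

theory Submission
  imports Defs
begin

text \<open>
  The theorem becomes transparent in other coordinates on the Neron-Severi space.  Put
  \<open>y\<^sub>i = d - m\<^sub>i\<close> and \<open>h = (n + 1) d - M\<close>; then \<open>2 d = (\<Sum>i. y\<^sub>i) - h\<close>.  Conditions (A) and (B)
  say \<open>0 \<le> y\<^sub>i \<le> h\<close>.  With \<open>K\<close> the complement of \<open>I\<close>, condition (C) says that the sum of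
  \<open>h - y\<^sub>i\<close> over \<open>K\<close> and of \<open>y\<^sub>i\<close> over the complement of \<open>K\<close> is at least \<open>h\<close>, and as \<open>t\<close> varies,
  \<open>K\<close> runs through all sets of even cardinality.  So the inequalities define the cone over the
  demicube: the unit cube of dimension n + 3 from which the corners with an even number of ones have
  been cut off, and whose vertices are the 0/1-vectors with an odd number of ones.

  The geometry enters through one symmetry.  Choose two of the points, and homogeneous coordinates
  in which the other n + 1 points are the coordinate points.  General position puts the two
  points, \<open>u\<close> and \<open>w\<close>, into the torus, and the Cremona transformation that sends \<open>x\<^sub>j\<close> to
  \<open>u\<^sub>j w\<^sub>j / x\<^sub>j\<close> interchanges them.  It acts on forms by \<open>x\<^sup>a \<mapsto> c\<^sup>a x\<^sup>e\<^sup>-\<^sup>a\<close> with \<open>c = u w\<close>,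
  \<open>e\<close> being given by the coordinates \<open>y\<close> of the n + 1 points, and on classes by replacing
  \<open>y\<^sub>i\<close> with \<open>h - y\<^sub>i\<close> for the two chosen \<open>i\<close> (\<open>has_section_flip_pair\<close>).  Hence the
  set of classes that have a nonzero form is invariant under all flips of evenly many coordinates.

  This gives both directions of (I).  The bounds \<open>m\<^sub>i \<le> d\<close> and \<open>0 \<le> d\<close> are trivial, and their
  images under the flips are all the inequalities (\<open>has_section_imp_demicube_cone\<close>).  Conversely,
  the constant form 1 represents the class of every exceptional divisor, the flips carry these classes to all
  vertices of the demicube, products of forms add classes, and every integral point of the
  cone with the right parity is a sum of vertices (\<open>demicube_cone_decomposition\<close>).

  For (II), a form factors into irreducible forms whose degrees and multiplicities add up, so the
  classes of forms lie in the effective cone, and the generators of the effective cone satisfy the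
  inequalities by (I).  The real points of the polyhedral cone are reached because the extreme
  points of the demicube are its 0/1-points (\<open>extreme_point_demicube_integral\<close>).  The facets
  are the ones claimed because the system of inequalities is irredundant:
  each inequality is violated by a point that satisfies all others (\<open>excess_violator_other\<close>).
\<close>

section \<open>Derivatives and values of polynomials\<close>

abbreviation lookup :: "('a \<Rightarrow>\<^sub>0 'b::zero) \<Rightarrow> 'a \<Rightarrow> 'b" where "lookup \<equiv> Poly_Mapping.lookup"
abbreviation keys :: "('a \<Rightarrow>\<^sub>0 'b::zero) \<Rightarrow> 'a set" where "keys \<equiv> Poly_Mapping.keys"
abbreviation single :: "'a \<Rightarrow> 'b::zero \<Rightarrow> ('a \<Rightarrow>\<^sub>0 'b)" where "single \<equiv> Poly_Mapping.single"

lemma sum_of_monomials: "(\<Sum>a\<in>keys F. single a (lookup F a)) = F"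
proof (rule poly_mapping_eqI)
  fix b
  have "lookup (\<Sum>a\<in>keys F. single a (lookup F a)) b = (\<Sum>a\<in>keys F. if b = a then lookup F a else 0)"
    by (simp add: lookup_sum lookup_single when_def eq_commute)
  also have "\<dots> = lookup F b" by (simp add: in_keys_iff)
  finally show "lookup (\<Sum>a\<in>keys F. single a (lookup F a)) b = lookup F b" .
qed

lemma mpoly_induct [case_names monomial add]:
  assumes "\<And>a c. P (single a c)" and "\<And>F G. P F \<Longrightarrow> P G \<Longrightarrow> P (F + G)"
  shows "P (F :: 'v mpoly)"
proof -
  have "P (\<Sum>a\<in>A. single a (lookup F a))" if "finite A" for A
    using that
  proof induction
    case empty
    show ?case using assms(1)[of 0 0] by simp
  next
    case (insert x A)
    then show ?case using assms by simp
  qed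
  from this[OF finite_keys, of F] show ?thesis by (simp only: sum_of_monomials)
qed

text \<open>
  Bilinear identities only have to be checked on pairs of monomials.
\<close>

lemma mpoly_induct2:
  assumes "\<And>a b c e. P (single a c) (single b e)"
    and "\<And>F F' G. P F G \<Longrightarrow> P F' G \<Longrightarrow> P (F + F') G"
    and "\<And>F G G'. P F G \<Longrightarrow> P F G' \<Longrightarrow> P F (G + G')"
  shows "P (F :: 'v mpoly) (G :: 'w mpoly)"
proof (induction F rule: mpoly_induct)
  case (monomial a c)
  show ?case by (induction G rule: mpoly_induct) (use assms in auto)
qed (use assms in auto)

lemma pdiff_add: "pdiff j (F + G) = pdiff j F + pdiff j G"
  unfolding pdiff_def
  by (rule setsum_keys_plus_distrib) (auto simp: single_add distrib_left)

lemma pdiff_single: "pdiff j (single a c) = single (a - single j 1) (of_nat (lookup a j) * c)"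
  by (cases "c = 0") (auto simp: pdiff_def)

lemma pdiff_zero [simp]: "pdiff j 0 = 0"
  by (simp add: pdiff_def)

lemma pdiff_sum: "pdiff j (sum f A) = (\<Sum>x\<in>A. pdiff j (f x))"
  by (induction A rule: infinite_finite_induct) (auto simp: pdiff_add)

lemma minus_single_add_single:
  "lookup a j > 0 \<Longrightarrow> a - single j 1 + single j 1 = (a :: 'v \<Rightarrow>\<^sub>0 nat)"
  by (rule poly_mapping_eqI) (auto simp: lookup_add lookup_minus lookup_single when_def)

lemma lookup_pdiff: "lookup (pdiff j F) b = of_nat (Suc (lookup b j)) * lookup F (b + single j 1)"
proof (induction F rule: mpoly_induct)
  case (monomial a c)
  show ?case
  proof (cases "lookup a j = 0")
    case True
    then have "a \<noteq> b + single j 1" by (auto simp: lookup_add)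
    then show ?thesis by (simp add: pdiff_single True lookup_single)
  next
    case False
    have "a - single j 1 = b \<longleftrightarrow> a = b + single j 1"
      using minus_single_add_single[of a j] False by auto
    then show ?thesis using False
      by (auto simp: pdiff_single lookup_single when_def lookup_add)
  qed
next
  case (add F G)
  then show ?case by (simp add: pdiff_add lookup_add distrib_left)
qed

lemma pdiff_mult: "pdiff j (F * G) = pdiff j F * G + F * pdiff j G"
proof (induction F G rule: mpoly_induct2)
  case (1 a b c e)
  have A: "single (a + b - single j 1) (of_nat (lookup a j) * (c * e))
      = single (a - single j 1) (of_nat (lookup a j) * c) * single b e"
  proof (cases "lookup a j = 0")
    case False
    then have "a + b - single j 1 = a - single j 1 + b"
      by (intro poly_mapping_eqI) (auto simp: lookup_add lookup_minus lookup_single when_def)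
    then show ?thesis by (simp add: mult_single mult.assoc)
  qed simp
  have B: "single (a + b - single j 1) (of_nat (lookup b j) * (c * e))
      = single a c * single (b - single j 1) (of_nat (lookup b j) * e)"
  proof (cases "lookup b j = 0")
    case False
    then have "a + b - single j 1 = a + (b - single j 1)"
      by (intro poly_mapping_eqI) (auto simp: lookup_add lookup_minus lookup_single when_def)
    then show ?thesis by (simp add: mult_single algebra_simps)
  qed simp
  show ?case
    by (simp only: mult_single[of a] pdiff_single lookup_add of_nat_add distrib_right single_add A B)
qed (simp_all add: pdiff_add algebra_simps)

lemma peval_add: "peval (F + G) x = peval F x + peval G x"
  unfolding peval_def
  by (rule setsum_keys_plus_distrib) (auto simp: distrib_right)

lemma peval_single: "peval (single a c) x = c * (\<Prod>j\<in>UNIV. (x $ j) ^ lookup a j)"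
  by (cases "c = 0") (auto simp: peval_def)

lemma peval_zero [simp]: "peval 0 x = 0"
  by (simp add: peval_def)

lemma peval_sum: "peval (sum f A) x = (\<Sum>y\<in>A. peval (f y) x)"
  by (induction A rule: infinite_finite_induct) (auto simp: peval_add)

lemma peval_mult: "peval (F * G) x = peval F x * peval G x"
  by (induction F G rule: mpoly_induct2)
     (simp_all add: mult_single peval_single lookup_add power_add prod.distrib peval_add algebra_simps)

lemma peval_const [simp]: "peval (single 0 c) x = c"
  by (simp add: peval_single)

lemma prod_power_single: "(\<Prod>i\<in>UNIV. f i ^ lookup (single (j::'v::finite) k) i) = (f j ^ k :: 'a::comm_monoid_mult)"
proof -
  have "(\<Prod>i\<in>UNIV. f i ^ lookup (single j k) i) = (\<Prod>i\<in>UNIV. if i = j then f j ^ k else 1)"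
    by (rule prod.cong) (auto simp: lookup_single when_def)
  then show ?thesis by simp
qed

lemma peval_linear: "peval (single (single j 1) c) x = c * x $ j"
  using prod_power_single[of "\<lambda>i. x $ i" j 1] by (simp add: peval_single)

section \<open>Order of vanishing\<close>

lemma vanishes_to_order_0 [simp]: "vanishes_to_order 0 F v"
  by (simp add: vanishes_to_order_def)

text \<open>
  Peeling off the innermost derivative allows induction on the order; every later
  statement about orders of vanishing goes through this recursion.
\<close>

lemma vanishes_to_order_Suc:
  "vanishes_to_order (Suc k) F v \<longleftrightarrow>
     peval F v = 0 \<and> (\<forall>j. vanishes_to_order k (pdiff j F) v)"
proof
  assume *: "vanishes_to_order (Suc k) F v"
  have "peval (foldr pdiff js (pdiff j F)) v = 0" if "length js < k" for js j
    using *[unfolded vanishes_to_order_def, rule_format, of "js @ [j]"] that by simp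
  moreover have "peval F v = 0"
    using *[unfolded vanishes_to_order_def, rule_format, of "[]"] by simp
  ultimately show "peval F v = 0 \<and> (\<forall>j. vanishes_to_order k (pdiff j F) v)"
    by (simp add: vanishes_to_order_def)
next
  assume *: "peval F v = 0 \<and> (\<forall>j. vanishes_to_order k (pdiff j F) v)"
  show "vanishes_to_order (Suc k) F v"
    unfolding vanishes_to_order_def
  proof (intro allI impI)
    fix js :: "'a list"
    assume "length js < Suc k"
    then show "peval (foldr pdiff js F) v = 0"
      using * by (cases js rule: rev_cases) (auto simp: vanishes_to_order_def)
  qed
qed

lemma vanishes_to_order_mono: "vanishes_to_order k F v \<Longrightarrow> k' \<le> k \<Longrightarrow> vanishes_to_order k' F v"
  by (auto simp: vanishes_to_order_def)

lemma vanishes_to_order_zero [simp]: "vanishes_to_order k 0 v"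
  by (induction k) (auto simp: vanishes_to_order_Suc)

lemma vanishes_to_order_add:
  "vanishes_to_order k F v \<Longrightarrow> vanishes_to_order k G v \<Longrightarrow> vanishes_to_order k (F + G) v"
  by (induction k arbitrary: F G) (auto simp: vanishes_to_order_Suc peval_add pdiff_add)

lemma vanishes_to_order_sum:
  "(\<And>x. x \<in> A \<Longrightarrow> vanishes_to_order k (f x) v) \<Longrightarrow> vanishes_to_order k (sum f A) v"
  by (induction A rule: infinite_finite_induct) (auto simp: vanishes_to_order_add)

text \<open>
  The Leibniz rule lowers the order of one factor by one and keeps the other.  The slack in
  \<open>n \<le> k + l\<close> covers the truncated case, in which one of the two orders is already 0.
\<close>

lemma vanishes_to_order_mult_le:
  "vanishes_to_order k F v \<Longrightarrow> vanishes_to_order l G v \<Longrightarrow> n \<le> k + l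
     \<Longrightarrow> vanishes_to_order n (F * G) v"
proof (induction n arbitrary: k l F G)
  case (Suc n)
  have "peval F v = 0 \<or> peval G v = 0"
    using Suc.prems by (cases k; cases l) (auto simp: vanishes_to_order_Suc)
  moreover have "vanishes_to_order n (pdiff j F * G) v" for j
  proof (cases k)
    case 0
    show ?thesis by (rule Suc.IH[of 0 _ n]) (use 0 Suc.prems in \<open>auto intro: vanishes_to_order_mono\<close>)
  next
    case (Suc k')
    show ?thesis by (rule Suc.IH[of k' _ l]) (use Suc Suc.prems in \<open>auto simp: vanishes_to_order_Suc\<close>)
  qed
  moreover have "vanishes_to_order n (F * pdiff j G) v" for j
  proof (cases l)
    case 0
    show ?thesis by (rule Suc.IH[of n _ 0]) (use 0 Suc.prems in \<open>auto intro: vanishes_to_order_mono\<close>)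
  next
    case (Suc l')
    show ?thesis by (rule Suc.IH[of k _ l']) (use Suc Suc.prems in \<open>auto simp: vanishes_to_order_Suc\<close>)
  qed
  ultimately show ?case
    by (auto simp: vanishes_to_order_Suc peval_mult pdiff_mult intro!: vanishes_to_order_add)
qed simp

lemma vanishes_to_order_multiple: "vanishes_to_order k G v \<Longrightarrow> vanishes_to_order k (F * G) v"
  by (rule vanishes_to_order_mult_le[of 0]) auto

section \<open>Homogeneous polynomials\<close>

lemma mdegree_add: "mdegree (a + b) = mdegree a + mdegree b"
  by (simp add: mdegree_def lookup_add sum.distrib)

lemma mdegree_single [simp]: "mdegree (single j k) = k"
  by (simp add: mdegree_def lookup_single when_def)

lemma mdegree_zero [simp]: "mdegree 0 = 0"
  by (simp add: mdegree_def)

lemma homogeneous_zero [simp]: "homogeneous d 0"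
  by (simp add: homogeneous_def)

lemma homogeneous_add: "homogeneous d F \<Longrightarrow> homogeneous d G \<Longrightarrow> homogeneous d (F + G)"
  using keys_add[of F G] by (auto simp: homogeneous_def)

lemma homogeneous_sum: "(\<And>x. x \<in> A \<Longrightarrow> homogeneous d (f x)) \<Longrightarrow> homogeneous d (sum f A)"
  by (induction A rule: infinite_finite_induct) (auto simp: homogeneous_add)

lemma homogeneous_mult: "homogeneous d F \<Longrightarrow> homogeneous e G \<Longrightarrow> homogeneous (d + e) (F * G)"
  using keys_mult[of F G] by (fastforce simp: homogeneous_def mdegree_add)

lemma homogeneous_const [simp]: "homogeneous 0 (single 0 c)"
  by (simp add: homogeneous_def)

lemma homogeneous_one [simp]: "homogeneous 0 1"
  by (simp add: homogeneous_def)

lemma homogeneous_power: "homogeneous d F \<Longrightarrow> homogeneous (d * k) (F ^ k)"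
proof (induction k)
  case (Suc k)
  then show ?case using homogeneous_mult[of d F "d * k" "F ^ k"] by simp
qed simp

lemma homogeneous_prod:
  "(\<And>x. x \<in> A \<Longrightarrow> homogeneous (d x) (f x)) \<Longrightarrow> homogeneous (sum d A) (prod f A)"
  by (induction A rule: infinite_finite_induct) (auto simp: homogeneous_mult)

lemma homogeneous_pdiff:
  assumes "homogeneous d F"
  shows "homogeneous (d - 1) (pdiff j F)"
  unfolding homogeneous_def
proof
  fix b assume "b \<in> keys (pdiff j F)"
  then have "b + single j 1 \<in> keys F" by (auto simp: in_keys_iff lookup_pdiff)
  then have "mdegree b + 1 = d" using assms by (force simp: homogeneous_def mdegree_add)
  then show "mdegree b = d - 1" by simp
qed

lemma lookup_le_mdegree: "lookup a j \<le> mdegree a"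
  unfolding mdegree_def by (rule member_le_sum) auto

lemma lookup_eq_mdegree:
  assumes "lookup a j = mdegree a" shows "a = single j (mdegree a)"
proof (rule poly_mapping_eqI)
  fix i
  have "(\<Sum>i\<in>UNIV - {j}. lookup a i) = 0"
    using assms unfolding mdegree_def by (simp add: sum.remove[of UNIV j])
  then show "lookup a i = lookup (single j (mdegree a)) i"
    using assms by (auto simp: lookup_single when_def)
qed

section \<open>Order of vanishing at coordinate points\<close>

lemma obtain_other_variable:
  assumes "a \<noteq> single i (mdegree a)"
  obtains j where "j \<noteq> i" "lookup a j \<noteq> 0"
proof -
  have "lookup a i \<noteq> mdegree a" using lookup_eq_mdegree[of a i] assms by auto
  then have "(\<Sum>j\<in>UNIV - {i}. lookup a j) \<noteq> 0"
    unfolding mdegree_def by (simp add: sum.remove[of UNIV i])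
  then show ?thesis using that by (metis DiffE insertI1 sum.neutral)
qed

text \<open>
  In the affine chart \<open>x\<^sub>i = 1\<close> around the coordinate point, the monomial \<open>x\<^sup>a\<close> of a form of degree
  \<open>d\<close> has order \<open>d - a\<^sub>i\<close>, and different monomials cannot cancel.
\<close>

lemma vanishes_at_axis_iff:
  assumes "homogeneous d F"
  shows "vanishes_to_order k F (axis i 1) \<longleftrightarrow> (\<forall>a\<in>keys F. lookup a i + k \<le> d)"
  using assms
proof (induction k arbitrary: d F)
  case 0
  then show ?case by (metis add_0_right homogeneous_def lookup_le_mdegree vanishes_to_order_0)
next
  case (Suc k)
  have eval: "peval F (axis i 1) = lookup F (single i d)"
  proof -
    have "(\<Prod>j\<in>UNIV. (axis i 1 :: complex ^ 'a) $ j ^ lookup a j) = (if a = single i d then 1 else 0)"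
      if "a \<in> keys F" for a
    proof (cases "a = single i d")
      case True
      show ?thesis
        using prod_power_single[of "\<lambda>j. (axis i 1 :: complex ^ 'a) $ j" i d] True by simp
    next
      case False
      have deg: "mdegree a = d" using that Suc.prems by (auto simp: homogeneous_def)
      with False obtain j where "j \<noteq> i" "lookup a j \<noteq> 0"
        using obtain_other_variable[of a i] deg by auto
      then have "(axis i 1 :: complex ^ 'a) $ j ^ lookup a j = 0" by (simp add: axis_def)
      then show ?thesis using False by (auto intro: prod_zero)
    qed
    then have "peval F (axis i 1) = (\<Sum>a\<in>keys F. if a = single i d then lookup F a else 0)"
      unfolding peval_def by (intro sum.cong) auto
    then show ?thesis by (simp add: in_keys_iff)
  qed
  have IH: "vanishes_to_order k (pdiff j F) (axis i 1)
      \<longleftrightarrow> (\<forall>b\<in>keys (pdiff j F). lookup b i + k \<le> d - 1)" for j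
    by (rule Suc.IH) (rule homogeneous_pdiff[OF Suc.prems])
  have keys_pdiff: "b \<in> keys (pdiff j F) \<longleftrightarrow> b + single j 1 \<in> keys F" for b j
    by (simp add: in_keys_iff lookup_pdiff del: of_nat_Suc)
  show ?case
  proof
    assume van: "vanishes_to_order (Suc k) F (axis i 1)"
    show "\<forall>a\<in>keys F. lookup a i + Suc k \<le> d"
    proof
      fix a assume a: "a \<in> keys F"
      then have deg: "mdegree a = d" using Suc.prems by (auto simp: homogeneous_def)
      have "a \<noteq> single i d"
        using van eval a by (auto simp: vanishes_to_order_Suc)
      then obtain j where j: "j \<noteq> i" "lookup a j \<noteq> 0"
        using obtain_other_variable[of a i] deg by auto
      define b where "b = a - single j 1"
      have ab: "a = b + single j 1" using j minus_single_add_single[of a j] by (simp add: b_def)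
      have "lookup b i + k \<le> d - 1"
        using van IH[of j] a ab keys_pdiff by (auto simp: vanishes_to_order_Suc)
      moreover have "lookup a i = lookup b i" using ab j by (simp add: lookup_add lookup_single)
      moreover have "d > 0" using lookup_le_mdegree[of a j] j deg by simp
      ultimately show "lookup a i + Suc k \<le> d" by simp
    qed
  next
    assume *: "\<forall>a\<in>keys F. lookup a i + Suc k \<le> d"
    then have "single i d \<notin> keys F" by fastforce
    moreover have "vanishes_to_order k (pdiff j F) (axis i 1)" for j
      unfolding IH
    proof
      fix b assume "b \<in> keys (pdiff j F)"
      then have "lookup (b + single j 1) i + Suc k \<le> d" using * keys_pdiff by blast
      then show "lookup b i + k \<le> d - 1" by (simp add: lookup_add)
    qed
    ultimately show "vanishes_to_order (Suc k) F (axis i 1)"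
      using eval by (simp add: vanishes_to_order_Suc in_keys_iff)
  qed
qed

section \<open>Order of vanishing at points of the torus\<close>

definition var :: "'v \<Rightarrow> 'v mpoly" where
  "var j = single (single j 1) 1"

text \<open>
  The logarithmic derivative \<open>x\<^sub>j \<partial>/\<partial>x\<^sub>j\<close>.  It is diagonal on monomials, with the exponents as
  eigenvalues, and this makes orders of vanishing on the torus easy to follow under maps that act
  monomial by monomial.
\<close>

definition euler :: "'v \<Rightarrow> 'v mpoly \<Rightarrow> 'v mpoly" where
  "euler j F = var j * pdiff j F"

lemma pdiff_var: "pdiff i (var j) = (if i = j then 1 else 0)"
  by (auto simp: var_def pdiff_single lookup_single)

lemma peval_var [simp]: "peval (var j) v = v $ j"
  using peval_linear[of j 1 v] by (simp add: var_def)

lemma euler_add: "euler j (F + G) = euler j F + euler j G"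
  by (simp add: euler_def pdiff_add distrib_left)

lemma euler_single: "euler j (single a c) = single a (of_nat (lookup a j) * c)"
proof (cases "lookup a j = 0")
  case False
  then have "single j 1 + (a - single j 1) = a"
    using minus_single_add_single[of a j] by (simp add: add.commute)
  then show ?thesis by (simp add: euler_def var_def pdiff_single mult_single)
qed (simp add: euler_def pdiff_single)

lemma lookup_euler: "lookup (euler j F) a = of_nat (lookup a j) * lookup F a"
  by (induction F rule: mpoly_induct)
     (auto simp: euler_single lookup_single when_def euler_add lookup_add distrib_left)

lemma vanishes_var_mult_iff:
  assumes "v $ j \<noteq> 0"
  shows "vanishes_to_order k (var j * G) v \<longleftrightarrow> vanishes_to_order k G v"
proof
  show "vanishes_to_order k (var j * G) v \<Longrightarrow> vanishes_to_order k G v"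
  proof (induction k arbitrary: G)
    case (Suc k)
    have "peval G v = 0" using Suc.prems assms by (auto simp: vanishes_to_order_Suc peval_mult)
    moreover have "vanishes_to_order k (pdiff i G) v" for i
    proof (rule Suc.IH)
      have G: "vanishes_to_order k G v"
        by (rule Suc.IH, rule vanishes_to_order_mono[OF Suc.prems]) simp
      have "vanishes_to_order k (pdiff i (var j * G)) v"
        using Suc.prems by (simp add: vanishes_to_order_Suc)
      moreover have "var j * pdiff i G = pdiff i (var j * G) + single 0 (if i = j then -1 else 0) * G"
        by (simp add: pdiff_mult pdiff_var single_uminus)
      ultimately show "vanishes_to_order k (var j * pdiff i G) v"
        using G by (auto intro!: vanishes_to_order_add vanishes_to_order_multiple)
    qed
    ultimately show ?case by (simp add: vanishes_to_order_Suc)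
  qed simp
qed (rule vanishes_to_order_multiple)

text \<open>
  On the torus the variables are units, so partial derivatives may be replaced by
  logarithmic ones.
\<close>

lemma vanishes_to_order_Suc_euler:
  assumes "\<And>j. v $ j \<noteq> 0"
  shows "vanishes_to_order (Suc k) F v \<longleftrightarrow>
     peval F v = 0 \<and> (\<forall>j. vanishes_to_order k (euler j F) v)"
  by (simp add: vanishes_to_order_Suc euler_def vanishes_var_mult_iff assms)

section \<open>Linear changes of coordinates\<close>

definition psubst :: "('v \<Rightarrow> 'w mpoly) \<Rightarrow> 'v::finite mpoly \<Rightarrow> 'w mpoly" where
  "psubst L F = (\<Sum>a\<in>keys F. single 0 (lookup F a) * (\<Prod>j\<in>UNIV. L j ^ lookup a j))"

lemma psubst_add: "psubst L (F + G) = psubst L F + psubst L G"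
  unfolding psubst_def
  by (rule setsum_keys_plus_distrib) (auto simp: single_add distrib_right)

lemma psubst_single: "psubst L (single a c) = single 0 c * (\<Prod>j\<in>UNIV. L j ^ lookup a j)"
  by (cases "c = 0") (auto simp: psubst_def)

lemma psubst_zero [simp]: "psubst L 0 = 0"
  by (simp add: psubst_def)

lemma psubst_sum: "psubst L (sum f A) = (\<Sum>x\<in>A. psubst L (f x))"
  by (induction A rule: infinite_finite_induct) (auto simp: psubst_add)

lemma single_zero_mult: "single 0 (c * e) = single 0 c * (single 0 e :: 'v mpoly)"
  by (simp add: mult_single)

lemma psubst_mult: "psubst L (F * G) = psubst L F * psubst L G"
proof (induction F G rule: mpoly_induct2)
  case (1 a b c e)
  show ?case
    by (simp add: mult_single[of a] psubst_single lookup_add power_add prod.distrib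
        single_zero_mult mult_ac)
qed (simp_all add: psubst_add algebra_simps)

lemma psubst_const [simp]: "psubst L (single 0 c) = single 0 c"
  by (simp add: psubst_single)

lemma psubst_one [simp]: "psubst L 1 = 1"
  using psubst_const[of L 1] by (simp del: psubst_const)

lemma psubst_power: "psubst L (F ^ k) = psubst L F ^ k"
  by (induction k) (auto simp: psubst_mult)

lemma psubst_prod: "psubst L (prod f A) = (\<Prod>x\<in>A. psubst L (f x))"
  by (induction A rule: infinite_finite_induct) (auto simp: psubst_mult)

lemma psubst_var [simp]: "psubst L (var j) = L j"
  using prod_power_single[of L j 1] by (simp add: var_def psubst_single)

lemma psubst_psubst: "psubst K (psubst L F) = psubst (\<lambda>j. psubst K (L j)) F"
  by (induction F rule: mpoly_induct)
     (simp_all add: psubst_single psubst_mult psubst_prod psubst_power psubst_add)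

lemma var_power: "var j ^ k = single (single j k) 1"
  by (induction k) (auto simp: var_def mult_single single_add[symmetric] simp flip: single_one)

lemma monomial_eq_prod_var: "single a c = single 0 c * (\<Prod>j\<in>UNIV. var j ^ lookup a (j::'v::finite))"
proof -
  have "(\<Prod>j\<in>A. var j ^ lookup a j) = single (\<Sum>j\<in>A. single j (lookup a j)) 1" for A
    by (induction A rule: infinite_finite_induct)
       (auto simp: var_power mult_single)
  moreover have "(\<Sum>j\<in>UNIV. single j (lookup a j)) = a"
    by (rule poly_mapping_eqI) (simp add: lookup_sum lookup_single when_def)
  ultimately show ?thesis by (simp add: mult_single)
qed

lemma psubst_var_id: "psubst var F = F"
  by (induction F rule: mpoly_induct)
     (simp_all add: psubst_single psubst_add monomial_eq_prod_var[symmetric])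

definition linear_subst :: "complex ^ 'v ^ 'v \<Rightarrow> 'v::finite mpoly \<Rightarrow> 'v mpoly" where
  "linear_subst A = psubst (\<lambda>j. \<Sum>i\<in>UNIV. single (single i 1) (A $ j $ i))"

lemma linear_form_eq: "single (single i 1) c = single 0 c * var i"
  by (simp add: var_def mult_single)

lemma linear_subst_inverse:
  assumes "A ** B = mat 1"
  shows "linear_subst B (linear_subst A F) = F"
proof -
  have "psubst (\<lambda>j. \<Sum>i\<in>UNIV. single (single i 1) (B $ j $ i)) (\<Sum>i\<in>UNIV. single (single i 1) (A $ j $ i))
     = var j" for j
  proof -
    have "psubst (\<lambda>j. \<Sum>i\<in>UNIV. single (single i 1) (B $ j $ i)) (\<Sum>i\<in>UNIV. single (single i 1) (A $ j $ i))
       = (\<Sum>i\<in>UNIV. single 0 (A $ j $ i) * (\<Sum>k\<in>UNIV. single 0 (B $ i $ k) * var k))"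
      by (simp only: linear_form_eq psubst_sum psubst_mult psubst_const psubst_var)
    also have "\<dots> = (\<Sum>k\<in>UNIV. \<Sum>i\<in>UNIV. single 0 (A $ j $ i * B $ i $ k) * var k)"
      by (subst sum.swap) (simp add: sum_distrib_left single_zero_mult mult.assoc)
    also have "\<dots> = (\<Sum>k\<in>UNIV. single 0 ((A ** B) $ j $ k) * var k)"
    proof -
      have "(\<Sum>i\<in>S. single 0 (f i)) = (single 0 (sum f S) :: 'a mpoly)" for f :: "'a \<Rightarrow> complex" and S
        by (induction S rule: infinite_finite_induct) (auto simp: single_add)
      then show ?thesis by (simp add: matrix_matrix_mult_def flip: sum_distrib_right)
    qed
    also have "\<dots> = (\<Sum>k\<in>UNIV. if k = j then var k else 0)"
      by (rule sum.cong) (auto simp: assms mat_def)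
    finally show ?thesis by simp
  qed
  then show ?thesis by (simp add: linear_subst_def psubst_psubst psubst_var_id)
qed

lemma linear_subst_mult: "linear_subst A (F * G) = linear_subst A F * linear_subst A G"
  by (simp add: linear_subst_def psubst_mult)

lemma linear_subst_eq_0_iff:
  assumes "A ** B = mat 1"
  shows "linear_subst A F = 0 \<longleftrightarrow> F = 0"
  using linear_subst_inverse[OF assms, of F] by (auto simp: linear_subst_def)

lemma homogeneous_linear_subst:
  assumes "homogeneous d F"
  shows "homogeneous d (linear_subst A F)"
  unfolding linear_subst_def psubst_def
proof (rule homogeneous_sum)
  fix a assume "a \<in> keys F"
  then have deg: "mdegree a = d" using assms by (auto simp: homogeneous_def)
  have lin: "homogeneous 1 (\<Sum>i\<in>UNIV. single (single i 1) (A $ j $ i))" for j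
    by (rule homogeneous_sum) (auto simp: homogeneous_def)
  have "homogeneous (\<Sum>j\<in>UNIV. 1 * lookup a j)
      (\<Prod>j\<in>UNIV. (\<Sum>i\<in>UNIV. single (single i 1) (A $ j $ i)) ^ lookup a j)"
    by (intro homogeneous_prod homogeneous_power lin)
  then have "homogeneous d (\<Prod>j\<in>UNIV. (\<Sum>i\<in>UNIV. single (single i 1) (A $ j $ i)) ^ lookup a j)"
    using deg by (simp add: mdegree_def)
  then show "homogeneous d (single 0 (lookup F a) *
      (\<Prod>j\<in>UNIV. (\<Sum>i\<in>UNIV. single (single i 1) (A $ j $ i)) ^ lookup a j))"
    using homogeneous_mult[OF homogeneous_const] by fastforce
qed

lemma peval_linear_subst: "peval (linear_subst A F) x = peval F (A *v x)"
proof (induction F rule: mpoly_induct)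
  case (monomial a c)
  have pw: "peval (G ^ k) x = peval G x ^ k" for G :: "'a mpoly" and k
    by (induction k) (auto simp: peval_mult simp flip: single_one)
  have pr: "peval (prod f S) x = (\<Prod>j\<in>S. peval (f j) x)" for f :: "'a \<Rightarrow> 'a mpoly" and S
    by (induction S rule: infinite_finite_induct) (auto simp: peval_mult simp flip: single_one)
  show ?case
    by (simp add: linear_subst_def psubst_single peval_mult pr pw peval_single[of a] peval_sum
        peval_linear[unfolded One_nat_def] matrix_vector_mult_def)
next
  case (add F G)
  then show ?case by (simp add: linear_subst_def psubst_add peval_add)
qed

text \<open>
  Chain rule.  Both sides obey the same Leibniz rule in \<open>F\<close>, so it is enough that they agree on
  constants and variables.
\<close>

lemma pdiff_linear_subst:
  "pdiff i (linear_subst A F) = (\<Sum>j\<in>UNIV. single 0 (A $ j $ i) * linear_subst A (pdiff j F))"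
proof -
  define L :: "'a \<Rightarrow> 'a mpoly" where "L = (\<lambda>j. \<Sum>i\<in>UNIV. single (single i 1) (A $ j $ i))"
  have dconst: "pdiff i (single 0 c) = 0" for c by (simp add: pdiff_single)
  have dL: "pdiff i (L j) = single 0 (A $ j $ i)" for j
  proof -
    have "pdiff i (L j) = (\<Sum>k\<in>UNIV. if k = i then single 0 (A $ j $ i) else 0)"
      unfolding L_def linear_form_eq pdiff_sum
      by (rule sum.cong) (auto simp: pdiff_mult dconst pdiff_var)
    then show ?thesis by simp
  qed
  have var: "pdiff i (psubst L (var k)) = (\<Sum>j\<in>UNIV. single 0 (A $ j $ i) * psubst L (pdiff j (var k)))" for k
  proof -
    have "(\<Sum>j\<in>UNIV. single 0 (A $ j $ i) * psubst L (pdiff j (var k)))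
       = (\<Sum>j\<in>UNIV. if j = k then single 0 (A $ j $ i) else 0)"
      by (rule sum.cong) (auto simp: pdiff_var)
    then show ?thesis by (simp add: dL)
  qed
  define good where "good F \<longleftrightarrow> pdiff i (psubst L F) = (\<Sum>j\<in>UNIV. single 0 (A $ j $ i) * psubst L (pdiff j F))" for F
  have const: "good (single 0 c)" for c by (simp add: good_def dconst pdiff_single)
  have mult: "good (F * G)" if "good F" "good G" for F G
    using that unfolding good_def
    by (simp add: psubst_mult pdiff_mult psubst_add sum_distrib_left sum_distrib_right sum.distrib algebra_simps)
  have one: "good 1" using const[of 1] by simp
  have pow: "good (F ^ k)" if "good F" for F k
    using that by (induction k) (auto simp: one mult)
  have prd: "good (prod f S)" if "\<And>j. good (f j)" for f :: "'a \<Rightarrow> 'a mpoly" and S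
    using that by (induction S rule: infinite_finite_induct) (auto simp: one mult)
  have "good F"
  proof (induction F rule: mpoly_induct)
    case (monomial a c)
    show ?case
      unfolding monomial_eq_prod_var[of a c]
      by (intro mult const prd pow) (use var in \<open>simp add: good_def\<close>)
  next
    case (add F G)
    then show ?case unfolding good_def by (simp add: psubst_add pdiff_add sum.distrib distrib_left)
  qed
  then show ?thesis by (simp add: good_def linear_subst_def L_def)
qed

lemma vanishes_linear_subst:
  "vanishes_to_order k F (A *v v) \<Longrightarrow> vanishes_to_order k (linear_subst A F) v"
  by (induction k arbitrary: F)
     (auto simp: vanishes_to_order_Suc peval_linear_subst pdiff_linear_subst
       intro!: vanishes_to_order_sum vanishes_to_order_multiple)

lemma vanishes_linear_subst_iff:
  assumes "A ** B = mat 1"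
  shows "vanishes_to_order k (linear_subst A F) v \<longleftrightarrow> vanishes_to_order k F (A *v v)"
proof
  have "B ** A = mat 1" using assms by (simp add: matrix_left_right_inverse)
  then have v: "B *v (A *v v) = v" by (simp add: matrix_vector_mul_assoc)
  assume "vanishes_to_order k (linear_subst A F) v"
  then have "vanishes_to_order k (linear_subst B (linear_subst A F)) (A *v v)"
    using vanishes_linear_subst[of k "linear_subst A F" B "A *v v"] by (simp add: v)
  then show "vanishes_to_order k F (A *v v)" by (simp add: linear_subst_inverse[OF assms])
qed (rule vanishes_linear_subst)

section \<open>Leading monomials and factors of forms\<close>

lemma lookup_mult_keys:
  fixes F G :: "'v mpoly"
  shows "lookup (F * G) c = (\<Sum>(a, b)\<in>keys F \<times> keys G. if a + b = c then lookup F a * lookup G b else 0)"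
proof -
  have "F * G = (\<Sum>a\<in>keys F. \<Sum>b\<in>keys G. single (a + b) (lookup F a * lookup G b))"
    by (subst (1 2) sum_of_monomials[symmetric]) (simp only: sum_product mult_single)
  also have "lookup \<dots> c = (\<Sum>(a, b)\<in>keys F \<times> keys G. if a + b = c then lookup F a * lookup G b else 0)"
    by (simp add: lookup_sum lookup_single when_def sum.cartesian_product case_prod_unfold)
  finally show ?thesis .
qed

text \<open>
  An injective additive map into an ordered group makes the product of the two largest monomials
  unique, so it cannot be cancelled.
\<close>

lemma leading_monomial_mult_ordered:
  fixes F G :: "'v mpoly" and W :: "('v \<Rightarrow>\<^sub>0 nat) \<Rightarrow> 'o :: linordered_ab_group_add"
  assumes "F \<noteq> 0" "G \<noteq> 0" "inj W" "\<And>a b. W (a + b) = W a + W b"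
  obtains a b where "a \<in> keys F" "b \<in> keys G" "a + b \<in> keys (F * G)"
    "\<And>a'. a' \<in> keys F \<Longrightarrow> W a' \<le> W a" "\<And>b'. b' \<in> keys G \<Longrightarrow> W b' \<le> W b"
proof -
  have max: "\<exists>a\<in>keys H. \<forall>a'\<in>keys H. W a' \<le> W a" if "H \<noteq> 0" for H :: "'v mpoly"
  proof -
    have ne: "W ` keys H \<noteq> {}" using that by simp
    then have "Max (W ` keys H) \<in> W ` keys H" by (intro Max_in) auto
    then show ?thesis by (metis Max_ge finite_imageI finite_keys image_iff image_eqI)
  qed
  obtain a where a: "a \<in> keys F" "\<And>a'. a' \<in> keys F \<Longrightarrow> W a' \<le> W a" using max[OF assms(1)] by blast
  obtain b where b: "b \<in> keys G" "\<And>b'. b' \<in> keys G \<Longrightarrow> W b' \<le> W b" using max[OF assms(2)] by blast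
  have uniq: "a' = a \<and> b' = b" if "a' \<in> keys F" "b' \<in> keys G" "a' + b' = a + b" for a' b'
  proof -
    have s: "W a' + W b' = W a + W b" using that assms(4) by metis
    have "W a' = W a"
    proof (rule ccontr)
      assume "W a' \<noteq> W a"
      then have "W a' < W a" using a(2)[OF that(1)] by simp
      then have "W a' + W b' < W a + W b" using b(2)[OF that(2)] by (rule add_less_le_mono)
      then show False using s by simp
    qed
    then have "a' = a" using assms(3) by (auto dest: injD)
    then show ?thesis using that by simp
  qed
  have "lookup (F * G) (a + b) = (\<Sum>x\<in>keys F \<times> keys G. if x = (a, b) then lookup F a * lookup G b else 0)"
    unfolding lookup_mult_keys by (rule sum.cong) (use uniq in \<open>auto split: if_splits\<close>)
  also have "\<dots> = lookup F a * lookup G b" using a b by simp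
  finally have "a + b \<in> keys (F * G)" using a b by (auto simp: in_keys_iff)
  then show ?thesis using that a b by blast
qed

text \<open>
  The weight \<open>w\<close> need not separate monomials.  Refining it to a lexicographic order, with the weight
  as the first entry and the exponents behind it, reduces the claim to the previous lemma.  The
  weights used below are plus and minus the degree, and the exponent of one variable.
\<close>

lemma leading_monomial_mult:
  fixes F G :: "'v::finite mpoly" and w :: "('v \<Rightarrow>\<^sub>0 nat) \<Rightarrow> int"
  assumes "F \<noteq> 0" "G \<noteq> 0" and add: "\<And>a b. w (a + b) = w a + w b"
  obtains a b where "a \<in> keys F" "b \<in> keys G" "a + b \<in> keys (F * G)"
    "\<And>a'. a' \<in> keys F \<Longrightarrow> w a' \<le> w a" "\<And>b'. b' \<in> keys G \<Longrightarrow> w b' \<le> w b"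
proof -
  obtain e :: "'v \<Rightarrow> nat" where e: "inj e"
    using finite_imp_inj_to_nat_seg[of "UNIV :: 'v set"] by auto
  \<comment> \<open>weight first, exponents behind it: the order on the values is lexicographic\<close>
  define W :: "('v \<Rightarrow>\<^sub>0 nat) \<Rightarrow> (nat \<Rightarrow>\<^sub>0 int)" where
    "W a = single 0 (w a) + (\<Sum>j\<in>UNIV. single (Suc (e j)) (int (lookup a j)))" for a
  have W0: "lookup (W a) 0 = w a" for a
    by (simp add: W_def lookup_add lookup_sum lookup_single)
  have WS: "lookup (W a) (Suc (e j)) = int (lookup a j)" for a j
    using e by (simp add: W_def lookup_add lookup_sum lookup_single when_def inj_eq)
  have "inj W"
  proof (rule injI)
    fix a b assume "W a = W b"
    then show "a = b" using WS by (intro poly_mapping_eqI) (metis of_nat_eq_iff)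
  qed
  moreover have "W (a + b) = W a + W b" for a b
    by (simp add: W_def add single_add lookup_add sum.distrib)
  moreover have "w a \<le> w b" if "W a \<le> W b" for a b
  proof -
    have "less_fun (lookup (W a)) (lookup (W b)) \<or> W a = W b"
      using that by transfer auto
    then show ?thesis
    proof
      assume "less_fun (lookup (W a)) (lookup (W b))"
      then obtain k where k: "lookup (W a) k < lookup (W b) k" "\<And>k'. k' < k \<Longrightarrow> lookup (W a) k' = lookup (W b) k'"
        by (auto simp: less_fun_def)
      show ?thesis
      proof (cases "k = 0")
        case True
        then show ?thesis using k(1) by (simp add: W0)
      next
        case False
        then show ?thesis using k(2)[of 0] by (simp add: W0)
      qed
    next
      assume "W a = W b" then show ?thesis using W0 by (metis order_refl)
    qed
  qed
  ultimately obtain a b where "a \<in> keys F" "b \<in> keys G" "a + b \<in> keys (F * G)"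
    "\<And>a'. a' \<in> keys F \<Longrightarrow> w a' \<le> w a" "\<And>b'. b' \<in> keys G \<Longrightarrow> w b' \<le> w b"
    using leading_monomial_mult_ordered[OF assms(1,2), where W = W] by metis
  then show ?thesis by (rule that)
qed

lemma mpoly_mult_neq_0: "F \<noteq> 0 \<Longrightarrow> G \<noteq> 0 \<Longrightarrow> F * G \<noteq> (0 :: 'v::finite mpoly)"
  using leading_monomial_mult[where F = F and G = G and w = "\<lambda>_. 0"] by fastforce

lemma keys_neq_empty: "F \<noteq> 0 \<Longrightarrow> keys F \<noteq> {}" for F :: "'v mpoly"
  by simp

lemma total_degree_homogeneous:
  assumes "homogeneous d F" "F \<noteq> 0"
  shows "total_degree F = d"
proof -
  have "mdegree ` keys F = {d}"
    using assms(1) keys_neq_empty[OF assms(2)] unfolding homogeneous_def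
    by (metis image_cong image_constant_conv)
  then show ?thesis by (simp add: total_degree_def)
qed

text \<open>
  The monomials of largest degree of the two factors survive in the product, and so do those of
  smallest degree; as the product has only one degree, largest and smallest degree agree.
\<close>

lemma homogeneous_factors:
  fixes F G :: "'v::finite mpoly"
  assumes "homogeneous d (F * G)" "F \<noteq> 0" "G \<noteq> 0"
  obtains dF dG where "homogeneous dF F" "homogeneous dG G" "d = dF + dG"
proof -
  obtain a b where ab: "a \<in> keys F" "b \<in> keys G" "a + b \<in> keys (F * G)"
    "\<And>a'. a' \<in> keys F \<Longrightarrow> int (mdegree a') \<le> int (mdegree a)"
    "\<And>b'. b' \<in> keys G \<Longrightarrow> int (mdegree b') \<le> int (mdegree b)"
    by (rule leading_monomial_mult[OF assms(2,3), where w = "\<lambda>a. int (mdegree a)"]) (auto simp: mdegree_add)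
  obtain a' b' where ab': "a' \<in> keys F" "b' \<in> keys G" "a' + b' \<in> keys (F * G)"
    "\<And>a. a \<in> keys F \<Longrightarrow> - int (mdegree a) \<le> - int (mdegree a')"
    "\<And>b. b \<in> keys G \<Longrightarrow> - int (mdegree b) \<le> - int (mdegree b')"
    by (rule leading_monomial_mult[OF assms(2,3), where w = "\<lambda>a. - int (mdegree a)"]) (auto simp: mdegree_add)
  have "mdegree a + mdegree b = d" "mdegree a' + mdegree b' = d"
    using ab(3) ab'(3) assms(1) unfolding homogeneous_def by (metis mdegree_add)+
  moreover have "mdegree a' \<le> mdegree a" "mdegree b' \<le> mdegree b"
    using ab(4)[OF ab'(1)] ab(5)[OF ab'(2)] by auto
  ultimately have eq: "mdegree a' = mdegree a" "mdegree b' = mdegree b" "d = mdegree a + mdegree b" by auto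
  have "homogeneous (mdegree a) F"
    unfolding homogeneous_def using ab(4) ab'(4) eq by (metis le_antisym neg_le_iff_le of_nat_le_iff)
  moreover have "homogeneous (mdegree b) G"
    unfolding homogeneous_def using ab(5) ab'(5) eq by (metis le_antisym neg_le_iff_le of_nat_le_iff)
  ultimately show ?thesis using that eq by blast
qed

lemma homogeneous_0_is_unit:
  fixes F :: "'v::finite mpoly"
  assumes "homogeneous 0 F" "F \<noteq> 0"
  shows "F dvd 1"
proof -
  have "keys F \<subseteq> {0}"
  proof
    fix a assume "a \<in> keys F"
    then have "mdegree a = 0" using assms by (auto simp: homogeneous_def)
    then have "a = 0" by (intro poly_mapping_eqI) (metis lookup_le_mdegree le_zero_eq lookup_zero)
    then show "a \<in> {0}" by simp
  qed
  then have F: "F = single 0 (lookup F 0)" 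
    by (intro poly_mapping_eqI) (auto simp: lookup_single when_def in_keys_iff)
  then have "lookup F 0 \<noteq> 0" using assms(2) by auto
  then have "F * single 0 (1 / lookup F 0) = 1"
    by (subst F) (simp add: mult_single)
  then show ?thesis by (metis dvdI)
qed

lemma not_unit_of_homogeneous:
  assumes "homogeneous d F" "F dvd (1 :: 'v::finite mpoly)"
  shows "d = 0"
proof -
  obtain G where G: "1 = F * G" using assms(2) by (auto elim: dvdE)
  then have "F \<noteq> 0" "G \<noteq> 0" by auto
  obtain e e' where "homogeneous e F" "homogeneous e' G" "0 = e + e'"
    by (rule homogeneous_factors[OF _ \<open>F \<noteq> 0\<close> \<open>G \<noteq> 0\<close>, of 0]) (auto simp flip: G)
  then show ?thesis using assms(1) keys_neq_empty[OF \<open>F \<noteq> 0\<close>] by (auto simp: homogeneous_def)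
qed

section \<open>The Cremona transformation of forms\<close>

definition monom_val :: "complex ^ 'v::finite \<Rightarrow> ('v \<Rightarrow>\<^sub>0 nat) \<Rightarrow> complex" where
  "monom_val c a = (\<Prod>j\<in>UNIV. (c $ j) ^ lookup a j)"

text \<open>
  On \<open>x\<^sup>a\<close> this is the substitution \<open>x\<^sub>j \<mapsto> c\<^sub>j / x\<^sub>j\<close> followed by multiplication with \<open>x\<^sup>e\<close>.
  It is used only if \<open>e\<close> bounds all exponents, so that the truncated difference is the true one.
\<close>

definition cremona :: "('v \<Rightarrow>\<^sub>0 nat) \<Rightarrow> complex ^ 'v::finite \<Rightarrow> 'v mpoly \<Rightarrow> 'v mpoly" where
  "cremona e c F = (\<Sum>a\<in>keys F. single (e - a) (lookup F a * monom_val c a))"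

lemma cremona_superset:
  assumes "finite K" "keys F \<subseteq> K"
  shows "cremona e c F = (\<Sum>a\<in>K. single (e - a) (lookup F a * monom_val c a))"
  unfolding cremona_def by (rule sum.mono_neutral_left) (use assms in \<open>auto simp: in_keys_iff\<close>)

lemma diff_add_cancel_exponent:
  "(\<And>j. lookup a j \<le> lookup e j) \<Longrightarrow> e - a + a = (e :: 'v \<Rightarrow>\<^sub>0 nat)"
  by (rule poly_mapping_eqI) (simp add: lookup_add lookup_minus)

lemma keys_cremona: "b \<in> keys (cremona e c F) \<Longrightarrow> \<exists>a\<in>keys F. b = e - a"
  using keys_sum[of "\<lambda>a. single (e - a) (lookup F a * monom_val c a)" "keys F"]
  by (auto simp: cremona_def split: if_splits)

lemma cremona_neq_0:
  assumes "F \<noteq> 0" "\<And>a j. a \<in> keys F \<Longrightarrow> lookup a j \<le> lookup e j" "\<And>j. c $ j \<noteq> 0"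
  shows "cremona e c F \<noteq> 0"
proof -
  obtain a where a: "a \<in> keys F" using keys_neq_empty[OF assms(1)] by blast
  have "lookup (cremona e c F) (e - a) = (\<Sum>b\<in>keys F. if b = a then lookup F a * monom_val c a else 0)"
    unfolding cremona_def lookup_sum
  proof (rule sum.cong)
    fix b assume b: "b \<in> keys F"
    have "b = a" if "e - b = e - a"
      using diff_add_cancel_exponent[of b e] diff_add_cancel_exponent[of a e] assms(2) a b that
      by (metis add_left_cancel)
    then show "lookup (single (e - b) (lookup F b * monom_val c b)) (e - a)
        = (if b = a then lookup F a * monom_val c a else 0)"
      by (auto simp: lookup_single when_def)
  qed simp
  also have "\<dots> \<noteq> 0" using a assms(3) by (auto simp: in_keys_iff monom_val_def)
  finally show ?thesis by auto
qed

lemma homogeneous_cremona: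
  assumes "homogeneous d F" "\<And>a j. a \<in> keys F \<Longrightarrow> lookup a j \<le> lookup e j"
  shows "homogeneous (mdegree e - d) (cremona e c F)"
  unfolding homogeneous_def
proof
  fix b assume "b \<in> keys (cremona e c F)"
  then obtain a where a: "a \<in> keys F" "b = e - a" using keys_cremona[of b e c F] by auto
  then have "b + a = e" using diff_add_cancel_exponent[of a e] assms(2) by simp
  then have "mdegree e = mdegree b + mdegree a" by (metis mdegree_add)
  then show "mdegree b = mdegree e - d" using assms(1) a by (auto simp: homogeneous_def)
qed

lemma peval_cremona:
  assumes "\<And>a j. a \<in> keys F \<Longrightarrow> lookup a j \<le> lookup e j" "\<And>j. c $ j = u $ j * w $ j"
  shows "peval (cremona e c F) u = monom_val u e * peval F w"
proof -
  have "monom_val u (e - a) * monom_val c a = monom_val u e * monom_val w a" if "a \<in> keys F" for a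
  proof -
    have "monom_val c a = monom_val u a * monom_val w a"
      by (simp add: monom_val_def assms(2) power_mult_distrib prod.distrib)
    moreover have "monom_val u (e - a) * monom_val u a = monom_val u (e - a + a)"
      by (simp add: monom_val_def lookup_add power_add prod.distrib)
    ultimately show ?thesis using diff_add_cancel_exponent[of a e] assms(1) that by (simp add: mult.assoc[symmetric])
  qed
  then have "lookup F a * monom_val c a * monom_val u (e - a) = monom_val u e * (lookup F a * monom_val w a)"
    if "a \<in> keys F" for a
    using that by (simp add: algebra_simps)
  then have "(\<Sum>a\<in>keys F. lookup F a * monom_val c a * monom_val u (e - a))
      = (\<Sum>a\<in>keys F. monom_val u e * (lookup F a * monom_val w a))"
    by (rule sum.cong[OF refl])
  then show ?thesis
    by (simp add: cremona_def peval_sum peval_single peval_def[of F] sum_distrib_left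
        flip: monom_val_def)
qed

text \<open>
  The exponent of \<open>x\<^sub>j\<close> changes from \<open>a\<^sub>j\<close> to \<open>e\<^sub>j - a\<^sub>j\<close>, hence so does the eigenvalue of the
  logarithmic derivative.
\<close>

lemma euler_cremona:
  assumes "\<And>a j. a \<in> keys F \<Longrightarrow> lookup a j \<le> lookup e j"
  shows "euler j (cremona e c F) = single 0 (of_nat (lookup e j)) * cremona e c F - cremona e c (euler j F)"
proof -
  have E: "euler j (sum f A) = (\<Sum>x\<in>A. euler j (f x))" for f :: "('a \<Rightarrow>\<^sub>0 nat) \<Rightarrow> 'a mpoly" and A
    by (simp add: euler_def pdiff_sum sum_distrib_left)
  have "cremona e c (euler j F) = (\<Sum>a\<in>keys F. single (e - a) (of_nat (lookup a j) * lookup F a * monom_val c a))"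
    by (subst cremona_superset[of "keys F"]) (auto simp: lookup_euler in_keys_iff)
  moreover have "euler j (cremona e c F) = (\<Sum>a\<in>keys F. single (e - a) (of_nat (lookup e j) * (lookup F a * monom_val c a))
      - single (e - a) (of_nat (lookup a j) * lookup F a * monom_val c a))"
    unfolding cremona_def E
    by (rule sum.cong) (auto simp: euler_single lookup_minus of_nat_diff assms algebra_simps simp flip: single_diff)
  ultimately show ?thesis
    by (simp add: sum_subtractf cremona_def sum_distrib_left mult_single del: single_of_nat)
qed

text \<open>
  The map \<open>x\<^sub>j \<mapsto> c\<^sub>j / x\<^sub>j\<close> is an automorphism of the torus that sends \<open>u\<close> to \<open>w\<close>, so it
  transports orders of vanishing.  Algebraically, the logarithmic derivatives of the transform are
  combinations of transforms of \<open>F\<close> and of its logarithmic derivatives, and induction applies.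
\<close>

lemma vanishes_cremona:
  assumes "\<And>a j. a \<in> keys F \<Longrightarrow> lookup a j \<le> lookup e j"
    and c: "\<And>j. c $ j = u $ j * w $ j" and u: "\<And>j. u $ j \<noteq> 0" and w: "\<And>j. w $ j \<noteq> 0"
    and "vanishes_to_order k F w"
  shows "vanishes_to_order k (cremona e c F) u"
  using assms(1,5)
proof (induction k arbitrary: F)
  case (Suc k)
  have F: "peval F w = 0" "vanishes_to_order k (euler j F) w" for j
    using Suc.prems(2) by (auto simp: vanishes_to_order_Suc_euler[OF w])
  have 1: "vanishes_to_order k (cremona e c F) u"
    by (rule Suc.IH) (use Suc.prems vanishes_to_order_mono[OF Suc.prems(2), of k] in auto)
  have 2: "vanishes_to_order k (cremona e c (euler j F)) u" for j
    by (rule Suc.IH) (use Suc.prems F in \<open>auto simp: in_keys_iff lookup_euler\<close>)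
  have "vanishes_to_order k (euler j (cremona e c F)) u" for j
  proof -
    have "euler j (cremona e c F) = single 0 (of_nat (lookup e j)) * cremona e c F
        + single 0 (-1) * cremona e c (euler j F)"
      by (simp add: euler_cremona[OF Suc.prems(1)] single_uminus)
    then show ?thesis using 1 2 by (auto intro!: vanishes_to_order_add vanishes_to_order_multiple)
  qed
  moreover have "peval (cremona e c F) u = 0"
    using F peval_cremona[OF Suc.prems(1) c] by simp
  ultimately show ?case by (simp add: vanishes_to_order_Suc_euler[OF u])
qed simp

section \<open>Coordinates adapted to points in general position\<close>

lemma general_position_independent:
  fixes p :: "'i::finite \<Rightarrow> complex ^ 'v::finite"
  assumes "general_position p" "card S = CARD('v)" "(\<Sum>i\<in>S. c i *s p i) = 0" "i \<in> S"
  shows "c i = 0"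
proof -
  have inj: "inj_on p S" and ind: "vec.independent (p ` S)"
    using assms(1,2) by (auto simp: general_position_def)
  have "(\<Sum>x\<in>p ` S. c (inv_into S p x) *s x) = (\<Sum>i\<in>S. c i *s p i)"
    by (simp add: sum.reindex[OF inj] inv_into_f_f[OF inj])
  then have "\<forall>x\<in>p ` S. c (inv_into S p x) = 0"
    using ind assms(3) by (auto simp: vec.dependent_finite)
  then show ?thesis using assms(4) by (simp add: inv_into_f_f[OF inj])
qed

text \<open>
  The matrix \<open>A\<close> has the remaining points as columns; \<open>u\<close> and \<open>w\<close> are the coordinates of the two
  chosen points with respect to this basis.
\<close>

lemma normal_coordinates:
  fixes p :: "'i::finite \<Rightarrow> complex ^ 'v::finite"
  assumes gp: "general_position p" and card: "CARD('i) = CARD('v) + 2" and "a \<noteq> b"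
  obtains A B :: "complex ^ 'v ^ 'v" and \<sigma> :: "'v \<Rightarrow> 'i" and u w :: "complex ^ 'v" where "A ** B = mat 1" "B ** A = mat 1" "bij_betw \<sigma> UNIV (UNIV - {a, b})"
    "\<And>j. A *v axis j 1 = p (\<sigma> j)" "A *v u = p a" "A *v w = p b"
    "\<And>j. u $ j \<noteq> 0" "\<And>j. w $ j \<noteq> 0"
proof -
  have "card (UNIV - {a, b}) = CARD('v)" using card \<open>a \<noteq> b\<close> by (simp add: card_Diff_subset)
  then obtain \<sigma> :: "'v \<Rightarrow> 'i" where \<sigma>: "bij_betw \<sigma> UNIV (UNIV - {a, b})"
    using finite_same_card_bij[of "UNIV :: 'v set" "UNIV - {a, b}"] by auto
  then have inj: "inj \<sigma>" and ran: "range \<sigma> = UNIV - {a, b}" by (auto simp: bij_betw_def)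
  define A :: "complex ^ 'v ^ 'v" where "A = (\<chi> i j. p (\<sigma> j) $ i)"
  have col: "column j A = p (\<sigma> j)" for j by (simp add: A_def column_def vec_eq_iff)
  have mult: "A *v x = (\<Sum>j\<in>UNIV. x $ j *s p (\<sigma> j))" for x
    by (simp add: matrix_mult_sum col)
  have reindex: "(\<Sum>j\<in>K. c j *s p (\<sigma> j)) = (\<Sum>i\<in>\<sigma> ` K. c (inv \<sigma> i) *s p i)" for c K
    by (subst sum.reindex) (use inj in \<open>auto simp: inv_f_f intro: inj_on_subset\<close>)
  have "\<exists>B. B ** A = mat 1"
    unfolding matrix_left_invertible_independent_columns col
  proof (intro allI impI)
    fix c j assume "(\<Sum>j\<in>UNIV. c j *s p (\<sigma> j)) = 0"
    then have "c (inv \<sigma> (\<sigma> j)) = 0"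
      using general_position_independent[OF gp, of "range \<sigma>" "\<lambda>i. c (inv \<sigma> i)" "\<sigma> j"]
      by (simp add: reindex card_image[OF inj])
    then show "c j = 0" by (simp add: inv_f_f[OF inj])
  qed
  then obtain B where BA: "B ** A = mat 1" by blast
  then have AB: "A ** B = mat 1" by (simp add: matrix_left_right_inverse)
  have axis: "A *v axis j 1 = p (\<sigma> j)" for j
  proof -
    have "A *v axis j 1 = (\<Sum>k\<in>UNIV. if k = j then p (\<sigma> j) else 0)"
      unfolding mult by (rule sum.cong) (auto simp: axis_def)
    then show ?thesis by simp
  qed
  \<comment> \<open>a vanishing coordinate would be a linear relation among \<open>CARD('v)\<close> of the points\<close>
  have torus: "x $ k \<noteq> 0" if "A *v x = p q" "q = a \<or> q = b" for x q k
  proof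
    assume "x $ k = 0"
    define S where "S = \<sigma> ` (UNIV - {k})"
    have q: "q \<notin> S" using ran that(2) by (auto simp: S_def)
    have "(\<Sum>j\<in>UNIV - {k}. x $ j *s p (\<sigma> j)) = p q"
      using that(1) \<open>x $ k = 0\<close> by (simp add: mult sum.remove[of UNIV k])
    then have rel: "(\<Sum>i\<in>S. x $ (inv \<sigma> i) *s p i) = p q" by (simp add: reindex S_def)
    define c where "c i = (if i = q then -1 else x $ (inv \<sigma> i))" for i
    have "(\<Sum>i\<in>insert q S. c i *s p i) = - p q + (\<Sum>i\<in>S. x $ (inv \<sigma> i) *s p i)"
      using q by (auto simp: c_def intro!: sum.cong)
    then have "(\<Sum>i\<in>insert q S. c i *s p i) = 0" by (simp add: rel)
    moreover have "card (insert q S) = CARD('v)"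
    proof -
      have "card S = CARD('v) - 1" unfolding S_def
        by (subst card_image) (use inj in \<open>auto intro: inj_on_subset simp: card_Diff_subset\<close>)
      then show ?thesis using q by (simp add: S_def)
    qed
    ultimately have "c q = 0" using general_position_independent[OF gp] by blast
    then show False by (simp add: c_def)
  qed
  have pa: "A *v (B *v x) = x" for x by (simp add: matrix_vector_mul_assoc AB)
  show ?thesis
  proof (rule that[of A B \<sigma> "B *v p a" "B *v p b"])
    show "A ** B = mat 1" "B ** A = mat 1" "bij_betw \<sigma> UNIV (UNIV - {a, b})" by fact+
    show "A *v axis j 1 = p (\<sigma> j)" for j by (rule axis)
    show "A *v (B *v p a) = p a" "A *v (B *v p b) = p b" by (rule pa)+
    show "(B *v p a) $ j \<noteq> 0" "(B *v p b) $ j \<noteq> 0" for j using torus pa by blast+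
  qed
qed

lemma coordinate_at_point:
  fixes p :: "'i::finite \<Rightarrow> complex ^ 'v::finite"
  assumes gp: "general_position p" and card: "CARD('i) = CARD('v) + 2"
  obtains A B :: "complex ^ 'v ^ 'v" and j :: 'v where "A ** B = mat 1" "A *v axis j 1 = p i"
proof -
  have "card (UNIV - {i}) = CARD('i) - 1" by (rule card_Diff_singleton) simp
  moreover have "0 < CARD('v)" by (simp add: card_gt_0_iff)
  ultimately have "2 \<le> card (UNIV - {i})" using card by linarith
  then obtain T where "T \<subseteq> UNIV - {i}" "card T = 2" by (rule obtain_subset_with_card_n)
  then obtain a b where ab: "a \<noteq> b" "a \<noteq> i" "b \<noteq> i" by (auto simp: card_2_iff)
  obtain A B :: "complex ^ 'v ^ 'v" and \<sigma> :: "'v \<Rightarrow> 'i" and u w :: "complex ^ 'v"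
    where A: "A ** B = mat 1" "bij_betw \<sigma> UNIV (UNIV - {a, b})"
    "\<And>j. A *v axis j 1 = p (\<sigma> j)"
    by (rule normal_coordinates[OF gp card ab(1)]) blast
  have "i \<in> range \<sigma>" using A(2) ab by (simp add: bij_betw_def)
  then obtain j where "i = \<sigma> j" by blast
  then show ?thesis using that[of A B j] A by simp
qed

lemma vanishing_order_le_degree:
  fixes p :: "'i::finite \<Rightarrow> complex ^ 'v::finite"
  assumes gp: "general_position p" and card: "CARD('i) = CARD('v) + 2"
    and F: "homogeneous d F" "F \<noteq> 0" and "vanishes_to_order k F (p i)"
  shows "k \<le> d"
proof -
  obtain A B :: "complex ^ 'v ^ 'v" and j :: 'v where A: "A ** B = mat 1" "A *v axis j 1 = p i" by (rule coordinate_at_point[OF gp card, of i])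
  have "vanishes_to_order k (linear_subst A F) (axis j 1)"
    using assms(5) A by (simp add: vanishes_linear_subst_iff)
  then have "\<forall>a\<in>keys (linear_subst A F). lookup a j + k \<le> d"
    using vanishes_at_axis_iff homogeneous_linear_subst F(1) by blast
  moreover have "linear_subst A F \<noteq> 0" using F(2) by (simp add: linear_subst_eq_0_iff[OF A(1)])
  ultimately show ?thesis using keys_neq_empty by fastforce
qed

lemma multiplicity_at_vanishes:
  fixes p :: "'i::finite \<Rightarrow> complex ^ 'v::finite"
  assumes gp: "general_position p" and card: "CARD('i) = CARD('v) + 2"
    and F: "homogeneous d F" "F \<noteq> 0"
  shows "vanishes_to_order (multiplicity_at F (p i)) F (p i)"
  unfolding multiplicity_at_def
  by (rule GreatestI_nat[where k = 0 and b = d]) (use vanishing_order_le_degree[OF assms] in auto)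

lemma le_multiplicity_at:
  fixes p :: "'i::finite \<Rightarrow> complex ^ 'v::finite"
  assumes gp: "general_position p" and card: "CARD('i) = CARD('v) + 2"
    and F: "homogeneous d F" "F \<noteq> 0" and "vanishes_to_order k F (p i)"
  shows "k \<le> multiplicity_at F (p i)"
  unfolding multiplicity_at_def
  by (rule Greatest_le_nat[where b = d]) (use vanishing_order_le_degree[OF assms(1-4)] assms(5) in auto)

text \<open>
  The order of a product does not exceed the sum of the orders: at a coordinate point the order is the degree minus
  the largest exponent of one variable, and these exponents add up by
  \<open>leading_monomial_mult\<close>.
\<close>

lemma vanishing_order_of_product:
  fixes p :: "'i::finite \<Rightarrow> complex ^ 'v::finite"
  assumes gp: "general_position p" and card: "CARD('i) = CARD('v) + 2"
    and F: "homogeneous dF F" "F \<noteq> 0" and G: "homogeneous dG G" "G \<noteq> 0"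
    and van: "vanishes_to_order k (F * G) (p i)"
  shows "\<exists>r s. k \<le> r + s \<and> vanishes_to_order r F (p i) \<and> vanishes_to_order s G (p i)"
proof -
  obtain A B :: "complex ^ 'v ^ 'v" and j :: 'v where A: "A ** B = mat 1" "A *v axis j 1 = p i" by (rule coordinate_at_point[OF gp card, of i])
  define F' G' where "F' = linear_subst A F" "G' = linear_subst A G"
  have nz: "F' \<noteq> 0" "G' \<noteq> 0" using F G by (auto simp: F'_G'_def linear_subst_eq_0_iff[OF A(1)])
  have hom: "homogeneous dF F'" "homogeneous dG G'"
    using F G by (auto simp: F'_G'_def homogeneous_linear_subst)
  have "vanishes_to_order k (F' * G') (axis j 1)"
    using van A by (simp add: F'_G'_def vanishes_linear_subst_iff flip: linear_subst_mult)
  then have FG: "\<forall>a\<in>keys (F' * G'). lookup a j + k \<le> dF + dG"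
    using vanishes_at_axis_iff homogeneous_mult hom by blast
  obtain a b where ab: "a \<in> keys F'" "b \<in> keys G'" "a + b \<in> keys (F' * G')"
    "\<And>a'. a' \<in> keys F' \<Longrightarrow> int (lookup a' j) \<le> int (lookup a j)"
    "\<And>b'. b' \<in> keys G' \<Longrightarrow> int (lookup b' j) \<le> int (lookup b j)"
    by (rule leading_monomial_mult[OF nz, where w = "\<lambda>a. int (lookup a j)"]) (auto simp: lookup_add)
  have le: "lookup a j \<le> dF" "lookup b j \<le> dG"
    using ab(1,2) hom lookup_le_mdegree unfolding homogeneous_def by metis+
  have "vanishes_to_order (dF - lookup a j) F' (axis j 1)"
    unfolding vanishes_at_axis_iff[OF hom(1)] using ab(4) le by fastforce
  moreover have "vanishes_to_order (dG - lookup b j) G' (axis j 1)"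
    unfolding vanishes_at_axis_iff[OF hom(2)] using ab(5) le by fastforce
  moreover have "k \<le> (dF - lookup a j) + (dG - lookup b j)"
    using FG ab(3) le by (auto simp: lookup_add)
  ultimately show ?thesis using A by (auto simp: F'_G'_def vanishes_linear_subst_iff)
qed

section \<open>Classes of forms and their flips\<close>

text \<open>
  The class with \<open>y\<^sub>i = d - m\<^sub>i\<close> and \<open>h = (\<Sum>i. y\<^sub>i) - 2 d\<close> has a nonzero form.  A negative \<open>m\<^sub>i\<close>
  becomes order 0: it stands for a multiple of the exceptional divisor in the fixed part.
\<close>

definition has_section :: "('i::finite \<Rightarrow> complex ^ 'v::finite) \<Rightarrow> int \<Rightarrow> ('i \<Rightarrow> int) \<Rightarrow> bool" where
  "has_section p h y \<longleftrightarrow> (\<exists>d F. 2 * int d = (\<Sum>i\<in>UNIV. y i) - h \<and> F \<noteq> 0 \<and> homogeneous d F \<and>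
      (\<forall>i. vanishes_to_order (nat (int d - y i)) F (p i)))"

text \<open>
  The reflection of the cube of side \<open>h\<close> that reverses the coordinates in \<open>K\<close>.
\<close>

definition flip :: "'a::ab_group_add \<Rightarrow> 'i set \<Rightarrow> ('i \<Rightarrow> 'a) \<Rightarrow> 'i \<Rightarrow> 'a" where
  "flip h K y i = (if i \<in> K then h - y i else y i)"

text \<open>
  Apply the Cremona transformation centred at the other points, with the exponents \<open>y\<close> as \<open>e\<close>.
  The exponent of \<open>x\<^sub>j\<close> in a form of degree \<open>d\<close> that vanishes to order \<open>d - y\<^sub>j\<close> at the \<open>j\<close>-th coordinate
  point is at most \<open>y\<^sub>j\<close>, and the transform satisfies the same bound; so the \<open>y\<^sub>j\<close> of the centres
  are kept.  The orders at \<open>u\<close> and \<open>w\<close> are exchanged while the degree changes from \<open>d\<close> to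
  \<open>(\<Sum>j. y\<^sub>j) - d\<close>, and this amounts to the flip of the two remaining coordinates.
\<close>

lemma has_section_flip_pair:
  fixes p :: "'i::finite \<Rightarrow> complex ^ 'v::finite"
  assumes gp: "general_position p" and card: "CARD('i) = CARD('v) + 2" and "a \<noteq> b"
    and "has_section p h y"
  shows "has_section p h (flip h {a, b} y)"
proof -
  obtain d F where d: "2 * int d = (\<Sum>i\<in>UNIV. y i) - h" and F: "F \<noteq> 0" "homogeneous d F"
    and van: "\<And>i. vanishes_to_order (nat (int d - y i)) F (p i)"
    using assms(4) by (auto simp: has_section_def)
  obtain A B :: "complex ^ 'v ^ 'v" and \<sigma> :: "'v \<Rightarrow> 'i" and u w :: "complex ^ 'v" where AB: "A ** B = mat 1" "B ** A = mat 1"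
    and \<sigma>: "bij_betw \<sigma> UNIV (UNIV - {a, b})" and axis: "\<And>j. A *v axis j 1 = p (\<sigma> j)"
    and uw: "A *v u = p a" "A *v w = p b" and u: "\<And>j. u $ j \<noteq> 0" and w: "\<And>j. w $ j \<noteq> 0"
    by (rule normal_coordinates[OF gp card assms(3)]) blast
  have split: "(\<Sum>i\<in>UNIV. f i) = f a + f b + (\<Sum>j\<in>UNIV. f (\<sigma> j))" for f :: "'i \<Rightarrow> int"
  proof -
    have "(\<Sum>j\<in>UNIV. f (\<sigma> j)) = sum f (UNIV - {a, b})"
      using sum.reindex_bij_betw[OF \<sigma>, of f] by simp
    then show ?thesis using \<open>a \<noteq> b\<close> by (simp add: sum_diff)
  qed
  have inS: "\<sigma> j \<noteq> a" "\<sigma> j \<noteq> b" for j using \<sigma> by (auto simp: bij_betw_def)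
  have surj: "\<exists>j. i = \<sigma> j" if "i \<noteq> a" "i \<noteq> b" for i
    using that \<sigma> by (auto simp: bij_betw_def image_iff set_eq_iff)
  define F' where "F' = linear_subst A F"
  have F': "F' \<noteq> 0" "homogeneous d F'"
    using F by (auto simp: F'_def linear_subst_eq_0_iff[OF AB(1)] homogeneous_linear_subst)
  have van': "vanishes_to_order k F' v \<longleftrightarrow> vanishes_to_order k F (A *v v)" for k v
    by (simp add: F'_def vanishes_linear_subst_iff[OF AB(1)])
  have low: "int (lookup a' j) \<le> y (\<sigma> j)" if "a' \<in> keys F'" for a' j
  proof -
    have "lookup a' j + nat (int d - y (\<sigma> j)) \<le> d"
      using that van[of "\<sigma> j"] vanishes_at_axis_iff[OF F'(2)] by (auto simp: van' axis)
    then show ?thesis by linarith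
  qed
  obtain a0 where a0: "a0 \<in> keys F'" using keys_neq_empty[OF F'(1)] by blast
  then have ynn: "y (\<sigma> j) \<ge> 0" for j using low[of a0 j] by linarith
  define e where "e = Abs_poly_mapping (\<lambda>j. nat (y (\<sigma> j)))"
  have e: "lookup e j = nat (y (\<sigma> j))" for j by (simp add: e_def)
  have le: "lookup a' j \<le> lookup e j" if "a' \<in> keys F'" for a' j
    using low[OF that, of j] by (simp add: e)
  have dege: "int (mdegree e) = (\<Sum>j\<in>UNIV. y (\<sigma> j))" by (simp add: mdegree_def e ynn)
  define c where "c = (\<chi> j. u $ j * w $ j)"
  define G where "G = cremona e c F'"
  define d' where "d' = mdegree e - d"
  have "d \<le> mdegree e"
  proof -
    have "mdegree a0 = d" using a0 F'(2) by (auto simp: homogeneous_def)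
    then show ?thesis using le[OF a0] by (auto simp: mdegree_def intro: sum_mono)
  qed
  then have d': "int d' = (\<Sum>j\<in>UNIV. y (\<sigma> j)) - int d" by (simp add: d'_def of_nat_diff dege)
  have G: "G \<noteq> 0" "homogeneous d' G"
    using cremona_neq_0[OF F'(1) le] homogeneous_cremona[OF F'(2) le] u w by (auto simp: G_def d'_def c_def)
  have Gaxis: "vanishes_to_order (nat (int d' - y (\<sigma> j))) G (axis j 1)" for j
    unfolding vanishes_at_axis_iff[OF G(2)]
  proof
    fix b' assume b': "b' \<in> keys G"
    have "int (lookup b' j) \<le> y (\<sigma> j)"
      using keys_cremona[of b' e c F'] b' ynn[of j] by (auto simp: G_def lookup_minus e)
    moreover have "lookup b' j \<le> d'"
      using b' G(2) lookup_le_mdegree[of b' j] by (auto simp: homogeneous_def)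
    ultimately show "lookup b' j + nat (int d' - y (\<sigma> j)) \<le> d'" by linarith
  qed
  have Gu: "vanishes_to_order (nat (int d - y b)) G u"
    unfolding G_def
    by (rule vanishes_cremona[OF le _ u w]) (use van[of b] in \<open>auto simp: c_def van' uw\<close>)
  have Gw: "vanishes_to_order (nat (int d - y a)) G w"
    unfolding G_def
    by (rule vanishes_cremona[OF le _ w u]) (use van[of a] in \<open>auto simp: c_def van' uw\<close>)
  have transport: "vanishes_to_order k (linear_subst B G) (A *v v) \<longleftrightarrow> vanishes_to_order k G v" for k v
    by (simp add: vanishes_linear_subst_iff[OF AB(2)] matrix_vector_mul_assoc AB)
  \<comment> \<open>the order at \<open>u\<close> required after the flip is the order of \<open>F\<close> at the other point\<close>
  have eq: "int d' - (h - y a) = int d - y b" "int d' - (h - y b) = int d - y a"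
    using d d' split[of y] by auto
  have "vanishes_to_order (nat (int d' - flip h {a, b} y i)) (linear_subst B G) (p i)" for i
  proof -
    consider "i = a" | "i = b" | j where "i = \<sigma> j" using surj by blast
    then show ?thesis
    proof cases
      case 1
      then show ?thesis using Gu transport[of _ u] by (simp add: uw flip_def eq)
    next
      case 2
      then show ?thesis using Gw transport[of _ w] by (simp add: uw flip_def eq)
    next
      case 3
      then show ?thesis using Gaxis[of j] transport[of _ "axis j 1"] by (simp add: axis flip_def inS)
    qed
  qed
  moreover have "2 * int d' = (\<Sum>i\<in>UNIV. flip h {a, b} y i) - h"
    using d d' split[of y] split[of "flip h {a, b} y"] by (simp add: flip_def inS)
  moreover have "linear_subst B G \<noteq> 0" "homogeneous d' (linear_subst B G)"
    using G by (auto simp: linear_subst_eq_0_iff[OF AB(2)] homogeneous_linear_subst)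
  ultimately show ?thesis by (auto simp: has_section_def)
qed

lemma has_section_flip:
  fixes p :: "'i::finite \<Rightarrow> complex ^ 'v::finite"
  assumes gp: "general_position p" and card: "CARD('i) = CARD('v) + 2"
    and "even (card K)" "has_section p h y"
  shows "has_section p h (flip h K y)"
  using assms(3,4)
proof (induction "card K" arbitrary: K y rule: less_induct)
  case less
  show ?case
  proof (cases "K = {}")
    case True
    then show ?thesis using less.prems by (simp add: flip_def[abs_def])
  next
    case False
    then obtain a where a: "a \<in> K" by blast
    moreover have "K \<noteq> {a}" using less.prems by auto
    ultimately obtain b where b: "b \<in> K" "a \<noteq> b" by blast
    have c: "card K = card (K - {a, b}) + 2"
      using a b card_mono[of K "{a, b}"] by (simp add: card_Diff_subset)
    then have "has_section p h (flip h (K - {a, b}) (flip h {a, b} y))"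
      by (intro less.hyps has_section_flip_pair[OF gp card b(2)]) (use less.prems in auto)
    moreover have "flip h (K - {a, b}) (flip h {a, b} y) = flip h K y"
      using a b by (auto simp: flip_def fun_eq_iff)
    ultimately show ?thesis by simp
  qed
qed

lemma has_section_nonneg:
  fixes p :: "'i::finite \<Rightarrow> complex ^ 'v::finite"
  assumes gp: "general_position p" and card: "CARD('i) = CARD('v) + 2"
    and "has_section p h y"
  shows "0 \<le> y i"
proof -
  obtain d F where "F \<noteq> 0" "homogeneous d F" "vanishes_to_order (nat (int d - y i)) F (p i)"
    using assms(3) by (auto simp: has_section_def)
  then have "nat (int d - y i) \<le> d" using vanishing_order_le_degree[OF gp card] by blast
  then show ?thesis by linarith
qed

text \<open>
  The corner inequality for \<open>K\<close> says that the \<open>L\<^sup>1\<close>-distance of \<open>y\<close> from the vertex of the cube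
  of side \<open>h\<close> given by \<open>K\<close> is at least \<open>h\<close>.
\<close>

definition demicube_cone :: "'a::linordered_idom \<Rightarrow> ('i::finite \<Rightarrow> 'a) \<Rightarrow> bool" where
  "demicube_cone h y \<longleftrightarrow> (\<forall>i. 0 \<le> y i \<and> y i \<le> h) \<and>
     (\<forall>K. even (card K) \<longrightarrow> h \<le> (\<Sum>i\<in>UNIV. flip h K y i))"

text \<open>
  The bound \<open>y\<^sub>i \<le> h\<close> is the flip of \<open>0 \<le> y\<^sub>i\<close>, and the corner inequality for \<open>K\<close> says that the form
  obtained by flipping \<open>K\<close> has nonnegative degree.
\<close>

lemma has_section_imp_demicube_cone:
  fixes p :: "'i::finite \<Rightarrow> complex ^ 'v::finite"
  assumes gp: "general_position p" and card: "CARD('i) = CARD('v) + 2"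
    and sec: "has_section p h y"
  shows "demicube_cone h y" "even ((\<Sum>i\<in>UNIV. y i) - h)"
proof -
  show "even ((\<Sum>i\<in>UNIV. y i) - h)"
    using sec unfolding has_section_def by (metis dvd_triv_left)
  have "y i \<le> h" for i
  proof -
    have "card (UNIV - {i}) = CARD('i) - 1" by (rule card_Diff_singleton) simp
    then have "card (UNIV - {i}) \<noteq> 0" using card by linarith
    then have "UNIV - {i} \<noteq> {}" by (metis card.empty)
    then obtain j where "j \<noteq> i" by blast
    then have "has_section p h (flip h {i, j} y)" by (intro has_section_flip_pair[OF gp card _ sec]) auto
    then show ?thesis using has_section_nonneg[OF gp card, of h "flip h {i, j} y" i] by (simp add: flip_def)
  qed
  moreover have "h \<le> (\<Sum>i\<in>UNIV. flip h K y i)" if "even (card K)" for K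
    using has_section_flip[OF gp card that sec] unfolding has_section_def
    by (metis diff_ge_0_iff_ge mult_nonneg_nonneg of_nat_0_le_iff zero_le_numeral)
  ultimately show "demicube_cone h y"
    using has_section_nonneg[OF gp card sec] by (auto simp: demicube_cone_def)
qed

text \<open>
  For a single point the vertex is the class of an exceptional divisor, and the constant form 1
  serves; other vertices differ from it by an even flip.
\<close>

lemma has_section_vertex:
  fixes p :: "'i::finite \<Rightarrow> complex ^ 'v::finite"
  assumes gp: "general_position p" and card: "CARD('i) = CARD('v) + 2" and "odd (card J)"
  shows "has_section p 1 (\<lambda>i. of_bool (i \<in> J))"
proof -
  obtain i where i: "i \<in> J" using assms(3) by fastforce
  have "has_section p 1 (\<lambda>k. of_bool (k = i))"
    unfolding has_section_def
    by (rule exI[of _ 0], rule exI[of _ 1]) (auto simp: of_bool_def)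
  moreover have "even (card (J - {i}))" using i assms(3) by (simp add: card_Diff_singleton)
  ultimately have "has_section p 1 (flip 1 (J - {i}) (\<lambda>k. of_bool (k = i)))"
    by (intro has_section_flip[OF gp card])
  moreover have "flip 1 (J - {i}) (\<lambda>k. of_bool (k = i)) = (\<lambda>k. of_bool (k \<in> J) :: int)"
    using i by (auto simp: flip_def fun_eq_iff)
  ultimately show ?thesis by simp
qed

lemma has_section_zero: "has_section p 0 (\<lambda>_. 0)"
  unfolding has_section_def by (rule exI[of _ 0], rule exI[of _ 1]) auto

lemma has_section_add:
  assumes "has_section p h y" "has_section p h' y'"
  shows "has_section p (h + h') (\<lambda>i. y i + y' i)"
proof -
  obtain d F where d: "2 * int d = (\<Sum>i\<in>UNIV. y i) - h" and F: "F \<noteq> 0" "homogeneous d F"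
    and vF: "\<And>i. vanishes_to_order (nat (int d - y i)) F (p i)"
    using assms(1) by (auto simp: has_section_def)
  obtain d' F' where d': "2 * int d' = (\<Sum>i\<in>UNIV. y' i) - h'" and F': "F' \<noteq> 0" "homogeneous d' F'"
    and vF': "\<And>i. vanishes_to_order (nat (int d' - y' i)) F' (p i)"
    using assms(2) by (auto simp: has_section_def)
  have "vanishes_to_order (nat (int (d + d') - (y i + y' i))) (F * F') (p i)" for i
    by (rule vanishes_to_order_mult_le[OF vF[of i] vF'[of i]]) linarith
  moreover have "2 * int (d + d') = (\<Sum>i\<in>UNIV. y i + y' i) - (h + h')"
    using d d' by (simp add: sum.distrib)
  ultimately show ?thesis
    using mpoly_mult_neq_0[OF F(1) F'(1)] homogeneous_mult[OF F(2) F'(2)] unfolding has_section_def by blast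
qed

section \<open>Integral points of the cone over the demicube\<close>

text \<open>
  The symmetric difference of \<open>A\<close> with a singleton.
\<close>

definition toggle :: "'i \<Rightarrow> 'i set \<Rightarrow> 'i set" where
  "toggle i A = (if i \<in> A then A - {i} else insert i A)"

lemma even_card_toggle: "finite A \<Longrightarrow> even (card (toggle i A)) \<longleftrightarrow> odd (card A)"
  by (cases "i \<in> A") (auto simp: toggle_def card_gt_0_iff dest: card_Diff_singleton)

text \<open>
  A decomposition of \<open>y\<close> into vertices of the unit cube, each given by its set of ones.
\<close>

definition covers :: "nat \<Rightarrow> ('i \<Rightarrow> int) \<Rightarrow> (nat \<Rightarrow> 'i set) \<Rightarrow> bool" where
  "covers H y J \<longleftrightarrow> (\<forall>i. y i = (\<Sum>s<H. of_bool (i \<in> J s)))"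

lemma covers_toggle:
  assumes "covers H y J" "s < H" "t < H" "s \<noteq> t" "(i \<in> J s) \<noteq> (i \<in> J t)"
  shows "covers H y (J(s := toggle i (J s), t := toggle i (J t)))" (is "covers H y ?J'")
  unfolding covers_def
proof
  fix k
  have split: "(\<Sum>r<H. f r) = f s + f t + (\<Sum>r\<in>{..<H} - {s, t}. f r)" for f :: "nat \<Rightarrow> int"
    using assms(2-4) by (simp add: sum_diff)
  have "(of_bool (k \<in> ?J' s) + of_bool (k \<in> ?J' t) :: int) = of_bool (k \<in> J s) + of_bool (k \<in> J t)"
    using assms(4,5) by (cases "k = i") (auto simp: toggle_def)
  moreover have "(\<Sum>r\<in>{..<H} - {s, t}. of_bool (k \<in> ?J' r)) = (\<Sum>r\<in>{..<H} - {s, t}. of_bool (k \<in> J r) :: int)"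
    by (rule sum.cong) auto
  ultimately show "y k = (\<Sum>r<H. of_bool (k \<in> ?J' r))"
    using assms(1) unfolding covers_def split by presburger
qed

text \<open>
  The \<open>L\<^sup>1\<close>-distance of \<open>y\<close> from the vertex \<open>K\<close> is the sum of the Hamming distances of the
  summands from \<open>K\<close>.
\<close>

lemma sum_flip_covers:
  fixes y :: "'i::finite \<Rightarrow> int"
  assumes "covers H y J"
  shows "(\<Sum>i\<in>UNIV. flip (int H) K y i) = (\<Sum>s<H. int (card {i. (i \<in> K) \<noteq> (i \<in> J s)}))"
proof -
  have "flip (int H) K y i = (\<Sum>s<H. of_bool ((i \<in> K) \<noteq> (i \<in> J s)))" for i
  proof (cases "i \<in> K")
    case True
    have "int H - (\<Sum>s<H. of_bool (i \<in> J s)) = (\<Sum>s<H. 1 - of_bool (i \<in> J s))"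
      by (simp add: sum_subtractf)
    also have "\<dots> = (\<Sum>s<H. of_bool (i \<notin> J s))" by (rule sum.cong) auto
    finally show ?thesis using assms True by (simp add: flip_def covers_def)
  qed (use assms in \<open>simp add: flip_def covers_def\<close>)
  then have "(\<Sum>i\<in>UNIV. flip (int H) K y i) = (\<Sum>s<H. \<Sum>i\<in>UNIV. of_bool ((i \<in> K) \<noteq> (i \<in> J s)))"
    by (simp only:) (rule sum.swap)
  then show ?thesis by (simp add: of_bool_def sum.If_cases Int_def)
qed

text \<open>
  By parity the number of sets of even size is even.  If two of these sets differ, exchanging a point
  between them makes both odd.  Otherwise they all equal one set \<open>K\<close>, and the corner inequality
  for \<open>K\<close> forces some set \<open>J r\<close> to differ from \<open>K\<close> in two points \<open>i\<close> and \<open>j\<close>; exchanging \<open>i\<close>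
  with one copy of \<open>K\<close> and \<open>j\<close> with another makes both copies odd and leaves \<open>J r\<close> odd.
\<close>

lemma odd_cover_exists:
  fixes y :: "'i::finite \<Rightarrow> int"
  assumes cone: "demicube_cone (int H) y" and parity: "even ((\<Sum>i\<in>UNIV. y i) - int H)"
    and "covers H y J"
  shows "\<exists>J. covers H y J \<and> (\<forall>s<H. odd (card (J s)))"
  using assms(3)
proof (induction "card {s. s < H \<and> even (card (J s))}" arbitrary: J rule: less_induct)
  case less
  define E where "E = {s. s < H \<and> even (card (J s))}"
  have finE: "finite E" by (simp add: E_def)
  have improve: ?case if "covers H y J'" "s \<in> E" "\<And>r. r < H \<Longrightarrow> even (card (J' r)) \<Longrightarrow> r \<in> E - {s}" for J' s
  proof (rule less.hyps[OF _ that(1)])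
    have "{s. s < H \<and> even (card (J' s))} \<subset> E" using that(2,3) by blast
    then show "card {s. s < H \<and> even (card (J' s))} < card {s. s < H \<and> even (card (J s))}"
      using psubset_card_mono[OF finE] by (simp add: E_def)
  qed
  show ?case
  proof (cases "E = {}")
    case True
    then show ?thesis using less.prems by (auto simp: E_def)
  next
    case False
    have "(\<Sum>i\<in>UNIV. y i) - int H = (\<Sum>s<H. int (card (J s)) - 1)"
      using sum_flip_covers[OF less.prems, of "{}"] by (simp add: flip_def sum_subtractf)
    then have "even (card {s \<in> {..<H}. odd (int (card (J s)) - 1)})"
      using parity even_sum_iff[of "{..<H}" "\<lambda>s. int (card (J s)) - 1"] by simp
    then have "even (card E)" by (simp add: E_def)
    obtain s where s: "s \<in> E" using False by blast
    have "E \<noteq> {s}" using \<open>even (card E)\<close> by auto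
    then obtain t where t: "t \<in> E" "t \<noteq> s" using s by blast
    have lt: "r \<in> E \<Longrightarrow> r < H" for r by (simp add: E_def)
    show ?thesis
    proof (cases "\<exists>s t. s \<in> E \<and> t \<in> E \<and> J s \<noteq> J t")
      case True
      then obtain s t where st: "s \<in> E" "t \<in> E" "J s \<noteq> J t" by blast
      then have "s \<noteq> t" by auto
      obtain i where i: "(i \<in> J s) \<noteq> (i \<in> J t)" using st by blast
      define J' where "J' = J(s := toggle i (J s), t := toggle i (J t))"
      have "odd (card (J' s))" "odd (card (J' t))"
        using st(1,2) \<open>s \<noteq> t\<close> by (auto simp: J'_def E_def even_card_toggle)
      moreover have "J' r = J r" if "r \<noteq> s" "r \<noteq> t" for r using that by (simp add: J'_def)
      ultimately have E': "r \<in> E - {s}" if "r < H" "even (card (J' r))" for r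
        using that by (cases "r = s \<or> r = t") (auto simp: E_def)
      have "covers H y J'"
        unfolding J'_def by (rule covers_toggle[OF less.prems lt[OF st(1)] lt[OF st(2)] \<open>s \<noteq> t\<close> i])
      from improve[OF this st(1) E'] show ?thesis .
    next
      case False
      define K where "K = J s"
      have K: "J r = K" if "r \<in> E" for r using False that s unfolding K_def by metis
      have "even (card K)" using s by (simp add: K_def E_def)
      then have le: "int H \<le> (\<Sum>r<H. int (card {i. (i \<in> K) \<noteq> (i \<in> J r)}))"
        using cone sum_flip_covers[OF less.prems] by (auto simp: demicube_cone_def)
      obtain r where r: "r < H" "card {i. (i \<in> K) \<noteq> (i \<in> J r)} > 1"
      proof (rule ccontr)
        assume "\<not> thesis"
        then have small: "card {i. (i \<in> K) \<noteq> (i \<in> J r)} \<le> 1" if "r < H" for r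
          using that \<open>\<And>r. \<lbrakk>r < H; 1 < card {i. (i \<in> K) \<noteq> (i \<in> J r)}\<rbrakk> \<Longrightarrow> thesis\<close> by force
        have "(\<Sum>r<H. int (card {i. (i \<in> K) \<noteq> (i \<in> J r)})) < (\<Sum>r<H. 1)"
        proof (rule sum_strict_mono_ex1)
          show "\<exists>a\<in>{..<H}. int (card {i. (i \<in> K) \<noteq> (i \<in> J a)}) < 1"
            using K[OF s] lt[OF s] by (intro bexI[of _ s]) auto
        qed (use small in force)+
        then show False using le by simp
      qed
      have rE: "r \<notin> E" using K r by auto
      define D where "D = {i. (i \<in> K) \<noteq> (i \<in> J r)}"
      have "card D > 1" using r by (simp add: D_def)
      then have "D \<noteq> {}" by auto
      then obtain i where i: "i \<in> D" by blast
      moreover have "D \<noteq> {i}" using \<open>card D > 1\<close> by auto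
      ultimately obtain j where j: "j \<in> D" "j \<noteq> i" by blast
      have ne: "r \<noteq> s" "r \<noteq> t" using rE s t by auto
      define J' where "J' = J(r := toggle i (J r), s := toggle i (J s))"
      have "covers H y J'"
        unfolding J'_def
        by (rule covers_toggle[OF less.prems r(1) lt[OF s] ne(1)]) (use i K s in \<open>auto simp: D_def\<close>)
      moreover define J'' where "J'' = J'(r := toggle j (J' r), t := toggle j (J' t))"
      ultimately have cov: "covers H y J''"
        unfolding J''_def
        by (intro covers_toggle[OF _ r(1) lt[OF t(1)] ne(2)])
           (use j K[OF t(1)] t ne in \<open>auto simp: D_def J'_def toggle_def\<close>)
      have "J'' r = toggle j (toggle i (J r))" "J'' s = toggle i (J s)" "J'' t = toggle j (J t)"
        using ne t(2) by (auto simp: J'_def J''_def)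
      then have "odd (card (J'' r))" "odd (card (J'' s))" "odd (card (J'' t))"
        using rE r(1) s t(1) by (auto simp: E_def even_card_toggle)
      moreover have "J'' q = J q" if "q \<noteq> r" "q \<noteq> s" "q \<noteq> t" for q
        using that by (simp add: J'_def J''_def)
      ultimately have E': "q \<in> E - {s}" if "q < H" "even (card (J'' q))" for q
        using that by (cases "q = r \<or> q = s \<or> q = t") (auto simp: E_def)
      from improve[OF cov s E'] show ?thesis .
    qed
  qed
qed

lemma demicube_cone_decomposition:
  fixes y :: "'i::finite \<Rightarrow> int"
  assumes "demicube_cone h y" and "even ((\<Sum>i\<in>UNIV. y i) - h)"
  obtains J where "covers (nat h) y J" "\<And>s. s < nat h \<Longrightarrow> odd (card (J s))"
proof -
  have y: "0 \<le> y i" "y i \<le> h" for i using assms(1) by (auto simp: demicube_cone_def)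
  then have h: "int (nat h) = h" by (metis nat_0_le order_trans)
  \<comment> \<open>stack the coordinates: the \<open>s\<close>-th layer consists of the points of height more than \<open>s\<close>\<close>
  have "covers (nat h) y (\<lambda>s. {i. int s < y i})"
    unfolding covers_def
  proof
    fix i
    have "{..<nat h} \<inter> {s. int s < y i} = {..<nat (y i)}" using y[of i] by auto
    then show "y i = (\<Sum>s<nat h. of_bool (i \<in> {i. int s < y i}))"
      using y[of i] by (simp add: of_bool_def sum.If_cases)
  qed
  then show ?thesis
    using odd_cover_exists[of "nat h" y] assms h that by auto
qed

theorem has_section_iff:
  fixes p :: "'i::finite \<Rightarrow> complex ^ 'v::finite"
  assumes gp: "general_position p" and card: "CARD('i) = CARD('v) + 2"
  shows "has_section p h y \<longleftrightarrow> demicube_cone h y \<and> even ((\<Sum>i\<in>UNIV. y i) - h)"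
proof
  assume *: "demicube_cone h y \<and> even ((\<Sum>i\<in>UNIV. y i) - h)"
  obtain J where J: "covers (nat h) y J" "\<And>s. s < nat h \<Longrightarrow> odd (card (J s))"
    using demicube_cone_decomposition[of h y] * by auto
  have "has_section p (int H) (\<lambda>i. \<Sum>s<H. of_bool (i \<in> J s))" if "H \<le> nat h" for H
    using that
  proof (induction H)
    case 0
    then show ?case using has_section_zero by simp
  next
    case (Suc H)
    have "has_section p (int H + 1) (\<lambda>i. (\<Sum>s<H. of_bool (i \<in> J s)) + of_bool (i \<in> J H))"
      by (rule has_section_add[OF Suc.IH has_section_vertex[OF gp card J(2)]]) (use Suc.prems in auto)
    then show ?case by (simp add: add.commute)
  qed
  from this[of "nat h"] have "has_section p (int (nat h)) y"
    using J(1) by (simp add: covers_def flip: fun_eq_iff)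
  moreover have "int (nat h) = h"
  proof -
    fix i :: 'i
    have "0 \<le> y i" "y i \<le> h" using * by (auto simp: demicube_cone_def)
    then show ?thesis by simp
  qed
  ultimately show "has_section p h y" by simp
qed (use has_section_imp_demicube_cone[OF gp card] in blast)

section \<open>Classes of forms in the effective cone\<close>

lemma convex_cone_hull_sum:
  "(\<And>x. x \<in> A \<Longrightarrow> f x \<in> convex_cone hull S) \<Longrightarrow> sum f A \<in> convex_cone hull S"
  by (induction A rule: infinite_finite_induct)
     (auto simp: convex_cone_hull_contains_0 convex_cone_hull_add)

lemma prime_class_in_effective_cone:
  assumes "Z \<in> prime_divisors"
  shows "prime_class p Z \<in> effective_cone p"
proof -
  have "effective (single Z 1)"
    using assms by (auto simp: effective_def divisors_def lookup_single when_def)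
  moreover have "divisor_class p (single Z 1) = prime_class p Z" by (simp add: divisor_class_def)
  ultimately show ?thesis unfolding effective_cone_def by (intro hull_inc) force
qed

text \<open>
  Lowering multiplicities adds exceptional divisors.
\<close>

lemma effective_cone_decrease:
  assumes "(d, m) \<in> effective_cone p" "\<And>i. m' $ i \<le> m $ i"
  shows "(d, m') \<in> effective_cone p"
proof -
  have "(m $ i - m' $ i) *\<^sub>R prime_class p (Exceptional i) \<in> effective_cone p" for i
    using prime_class_in_effective_cone[of "Exceptional i" p] assms(2)[of i]
    unfolding effective_cone_def by (intro convex_cone_hull_mul) (auto simp: prime_divisors_def)
  then have "(d, m) + (\<Sum>i\<in>UNIV. (m $ i - m' $ i) *\<^sub>R prime_class p (Exceptional i)) \<in> effective_cone p"
    using assms(1) unfolding effective_cone_def by (intro convex_cone_hull_add convex_cone_hull_sum)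
  moreover have "(\<Sum>i\<in>UNIV. (m $ i - m' $ i) *\<^sub>R prime_class p (Exceptional i)) = (0, m' - m)"
  proof -
    have "(\<Sum>i\<in>UNIV. (m $ i - m' $ i) *\<^sub>R - axis i (1::real)) = m' - m"
      by (simp add: vec_eq_iff axis_def if_distrib cong: if_cong)
    then show ?thesis by (simp add: prod_eq_iff fst_sum snd_sum)
  qed
  ultimately show ?thesis by simp
qed

text \<open>
  A reducible form splits into two forms of smaller degree, and the orders of vanishing can be
  distributed to the factors; an irreducible form is itself a prime divisor.
\<close>

lemma form_class_in_effective_cone:
  fixes p :: "'i::finite \<Rightarrow> complex ^ 'v::finite"
  assumes gp: "general_position p" and card: "CARD('i) = CARD('v) + 2"
    and "homogeneous d F" "F \<noteq> 0" "\<And>i. vanishes_to_order (m i) F (p i)"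
  shows "(real d, \<chi> i. real (m i)) \<in> effective_cone p"
  using assms(3-5)
proof (induction d arbitrary: F m rule: less_induct)
  case (less d)
  note F = less.prems(1,2)
  consider "d = 0" | "d > 0" "irreducible F" | "d > 0" "\<not> irreducible F" by blast
  then show ?case
  proof cases
    case 1
    then have "m i = 0" for i
      using vanishing_order_le_degree[OF gp card F less.prems(3), of i] by simp
    then have "(real d, \<chi> i. real (m i)) = 0" using 1 by (simp add: zero_prod_def zero_vec_def)
    then show ?thesis by (simp add: effective_cone_def convex_cone_hull_contains_0)
  next
    case 2
    have "Strict_Transform F \<in> prime_divisors" using 2 F by (auto simp: prime_divisors_def)
    then have "prime_class p (Strict_Transform F) \<in> effective_cone p" by (rule prime_class_in_effective_cone)
    then have "(real d, \<chi> i. real (multiplicity_at F (p i))) \<in> effective_cone p"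
      by (simp add: total_degree_homogeneous[OF F])
    then show ?thesis
      by (rule effective_cone_decrease) (use le_multiplicity_at[OF gp card F less.prems(3)] in simp)
  next
    case 3
    have "\<not> F dvd 1" using not_unit_of_homogeneous[OF F(1)] 3 by blast
    then obtain G H where GH: "F = G * H" "\<not> G dvd 1" "\<not> H dvd 1"
      using 3(2) F(2) by (auto simp: irreducible_def)
    then have nz: "G \<noteq> 0" "H \<noteq> 0" using F(2) by auto
    obtain dG dH where hom: "homogeneous dG G" "homogeneous dH H" "d = dG + dH"
      using homogeneous_factors[of d G H] F(1) GH(1) nz by auto
    have "dG \<noteq> 0" using homogeneous_0_is_unit[of G] hom(1) GH(2) nz(1) by metis
    moreover have "dH \<noteq> 0" using homogeneous_0_is_unit[of H] hom(2) GH(3) nz(2) by metis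
    ultimately have smaller: "dG < d" "dH < d" using hom(3) by auto
    have "\<forall>i. \<exists>r s. m i \<le> r + s \<and> vanishes_to_order r G (p i) \<and> vanishes_to_order s H (p i)"
      using vanishing_order_of_product[OF gp card hom(1) nz(1) hom(2) nz(2)] less.prems(3) GH(1) by blast
    then obtain r s where rs: "\<And>i. m i \<le> r i + s i" "\<And>i. vanishes_to_order (r i) G (p i)"
        "\<And>i. vanishes_to_order (s i) H (p i)"
      by metis
    have "(real dG, \<chi> i. real (r i)) \<in> effective_cone p" "(real dH, \<chi> i. real (s i)) \<in> effective_cone p"
      using less.IH[OF smaller(1) hom(1) nz(1) rs(2)] less.IH[OF smaller(2) hom(2) nz(2) rs(3)] by auto
    then have "(real dG, \<chi> i. real (r i)) + (real dH, \<chi> i. real (s i)) \<in> effective_cone p"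
      unfolding effective_cone_def by (rule convex_cone_hull_add)
    then have "(real d, \<chi> i. real (r i + s i)) \<in> effective_cone p"
      by (simp add: hom(3) plus_vec_def)
    then show ?thesis by (rule effective_cone_decrease) (use rs(1) in \<open>simp flip: of_nat_add\<close>)
  qed
qed

text \<open>
  The inverse of the change of coordinates from \<open>(d, m)\<close> to \<open>(h, y)\<close>.
\<close>

definition class_of :: "real \<Rightarrow> ('i \<Rightarrow> real) \<Rightarrow> 'i::finite N1" where
  "class_of h y = (((\<Sum>i\<in>UNIV. y i) - h) / 2, \<chi> i. ((\<Sum>i\<in>UNIV. y i) - h) / 2 - y i)"

lemma has_section_class:
  fixes p :: "'i::finite \<Rightarrow> complex ^ 'v::finite"
  assumes gp: "general_position p" and card: "CARD('i) = CARD('v) + 2" and "has_section p h y"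
  shows "class_of (of_int h) (\<lambda>i. of_int (y i)) \<in> effective_cone p"
proof -
  obtain d F where d: "2 * int d = (\<Sum>i\<in>UNIV. y i) - h" and F: "homogeneous d F" "F \<noteq> 0"
    and van: "\<And>i. vanishes_to_order (nat (int d - y i)) F (p i)"
    using assms(3) by (auto simp: has_section_def)
  have "2 * real d = (\<Sum>i\<in>UNIV. real_of_int (y i)) - of_int h"
    using arg_cong[OF d, of real_of_int] by simp
  then have "((\<Sum>i\<in>UNIV. real_of_int (y i)) - of_int h) / 2 = real d" by simp
  then have "class_of (of_int h) (\<lambda>i. of_int (y i)) = (real d, \<chi> i. real d - of_int (y i))"
    by (simp add: class_of_def)
  moreover have "(real d, \<chi> i. real d - of_int (y i)) \<in> effective_cone p"
    by (rule effective_cone_decrease[OF form_class_in_effective_cone[OF gp card F van]]) simp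
  ultimately show ?thesis by simp
qed

section \<open>The demicube and its extreme points\<close>

lemma flip_add: "flip (h + h') K (\<lambda>i. y i + y' i) i = flip h K y i + flip h' K y' i"
  by (simp add: flip_def)

lemma flip_mult: "flip (c * h) K (\<lambda>i. c * y i) i = c * flip h K y i" for c :: "'a::comm_ring"
  by (simp add: flip_def algebra_simps)

lemma demicube_cone_add:
  "demicube_cone h y \<Longrightarrow> demicube_cone h' y' \<Longrightarrow> demicube_cone (h + h') (\<lambda>i. y i + y' i)"
  by (auto simp: demicube_cone_def flip_add sum.distrib intro: add_mono)

lemma demicube_cone_mult:
  "demicube_cone h y \<Longrightarrow> 0 \<le> c \<Longrightarrow> demicube_cone (c * h) (\<lambda>i. c * y i)"
  by (auto simp: demicube_cone_def flip_mult intro: mult_left_mono simp flip: sum_distrib_left)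

lemma demicube_cone_of_int:
  "demicube_cone (of_int h :: real) (\<lambda>i. of_int (y i)) \<longleftrightarrow> demicube_cone h y"
proof -
  have "flip (of_int h :: real) K (\<lambda>i. of_int (y i)) i = of_int (flip h K y i)" for K i
    by (simp add: flip_def)
  then show ?thesis by (simp add: demicube_cone_def flip: of_int_sum)
qed

definition demicube :: "(real ^ 'i::finite) set" where
  "demicube = {y. demicube_cone 1 (\<lambda>i. y $ i)}"

lemma convex_demicube: "convex demicube"
proof (rule convexI)
  fix x y :: "real ^ 'i" and u v :: real
  assume *: "x \<in> demicube" "y \<in> demicube" "0 \<le> u" "0 \<le> v" "u + v = 1"
  then have "demicube_cone (u * 1 + v * 1) (\<lambda>i. u * x $ i + v * y $ i)"
    by (intro demicube_cone_add demicube_cone_mult) (auto simp: demicube_def)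
  moreover have "(\<lambda>i. u * x $ i + v * y $ i) = ($) (u *\<^sub>R x + v *\<^sub>R y)" by (simp add: fun_eq_iff)
  ultimately show "u *\<^sub>R x + v *\<^sub>R y \<in> demicube" using * by (simp add: demicube_def)
qed

lemma compact_demicube: "compact (demicube :: (real ^ 'i::finite) set)"
proof -
  have cont: "continuous_on UNIV (\<lambda>y :: real ^ 'i. flip 1 K (\<lambda>i. y $ i) i)" for K i
    by (cases "i \<in> K") (auto simp: flip_def intro!: continuous_intros)
  have "closed (demicube :: (real ^ 'i) set)"
    unfolding demicube_def demicube_cone_def
    by (intro closed_Collect_conj closed_Collect_all closed_Collect_imp closed_Collect_le continuous_intros cont)
       auto
  moreover have "bounded (demicube :: (real ^ 'i) set)"
    by (rule bounded_subset[OF bounded_cbox[of 0 "\<chi> i. 1"]])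
       (auto simp: demicube_def demicube_cone_def mem_box_cart)
  ultimately show ?thesis by (simp add: compact_eq_bounded_closed)
qed

lemma positive_lower_bound:
  assumes "finite A" "\<And>x. x \<in> A \<Longrightarrow> 0 < (x::real)"
  obtains e where "0 < e" "\<And>x. x \<in> A \<Longrightarrow> e \<le> x"
proof (rule that[of "Min (insert 1 A)"])
  show "0 < Min (insert 1 A)" using assms by (subst Min_gr_iff) auto
  show "Min (insert 1 A) \<le> x" if "x \<in> A" for x using assms that by (intro Min_le) auto
qed

text \<open>
  In every coordinate where \<open>K\<close> and \<open>K'\<close> differ, the two distances add up to 1, and there are at least
  two such coordinates.  If both distances sum up to 1, nothing is left for the other coordinates, which
  are therefore integral.
\<close>

lemma demicube_tight_pair:
  fixes y :: "real ^ 'i::finite"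
  assumes y: "y \<in> demicube" and K: "even (card K)" "even (card K')" "K \<noteq> K'"
    and tight: "(\<Sum>i\<in>UNIV. flip 1 K (($) y) i) = 1" "(\<Sum>i\<in>UNIV. flip 1 K' (($) y) i) = 1"
    and ab: "a \<noteq> b" "0 < y $ a" "y $ a < 1" "0 < y $ b" "y $ b < 1"
  shows "(a \<in> K) \<noteq> (a \<in> K')" "(b \<in> K) \<noteq> (b \<in> K')"
proof -
  define D where "D = (K - K') \<union> (K' - K)"
  have "card K + card K' = card D + 2 * card (K \<inter> K')"
  proof -
    have "card K = card (K - K') + card (K \<inter> K')" "card K' = card (K' - K) + card (K \<inter> K')"
      by (metis card_Diff_subset_Int card_mono Diff_Int2 Int_lower1 Int_lower2 Int_commute finite le_add_diff_inverse2)+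
    moreover have "card D = card (K - K') + card (K' - K)"
      unfolding D_def by (rule card_Un_disjoint) auto
    ultimately show ?thesis by simp
  qed
  then have "even (card D)" using K by presburger
  moreover have "card D \<noteq> 0" using K(3) by (auto simp: D_def)
  ultimately have D2: "card D \<ge> 2" by presburger
  have pos: "0 \<le> flip 1 L (($) y) i" for L i
    using y by (auto simp: demicube_def demicube_cone_def flip_def)
  have "(\<Sum>i\<in>UNIV. flip 1 K (($) y) i + flip 1 K' (($) y) i) = 2" using tight by (simp add: sum.distrib)
  moreover have "(\<Sum>i\<in>UNIV. flip 1 K (($) y) i + flip 1 K' (($) y) i)
      = (\<Sum>i\<in>D. flip 1 K (($) y) i + flip 1 K' (($) y) i) + (\<Sum>i\<in>-D. flip 1 K (($) y) i + flip 1 K' (($) y) i)"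
    using sum.subset_diff[of D UNIV "\<lambda>i. flip 1 K (($) y) i + flip 1 K' (($) y) i"]
    by (simp add: Compl_eq_Diff_UNIV add.commute)
  moreover have "(\<Sum>i\<in>D. flip 1 K (($) y) i + flip 1 K' (($) y) i) = (\<Sum>i\<in>D. 1)"
    by (rule sum.cong) (auto simp: D_def flip_def)
  ultimately have "(\<Sum>i\<in>-D. flip 1 K (($) y) i + flip 1 K' (($) y) i) \<le> 0" using D2 by simp
  then have zero: "flip 1 K (($) y) i + flip 1 K' (($) y) i = 0" if "i \<notin> D" for i
    using that sum_nonneg_eq_0_iff[of "-D" "\<lambda>i. flip 1 K (($) y) i + flip 1 K' (($) y) i"] pos
    by (smt (verit) ComplI finite sum_nonneg)
  have "a \<in> D" by (rule ccontr) (use zero[of a] ab in \<open>auto simp: flip_def split: if_splits\<close>)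
  moreover have "b \<in> D" by (rule ccontr) (use zero[of b] ab in \<open>auto simp: flip_def split: if_splits\<close>)
  ultimately show "(a \<in> K) \<noteq> (a \<in> K')" "(b \<in> K) \<noteq> (b \<in> K')" by (auto simp: D_def)
qed

text \<open>
  A point with exactly one fractional coordinate is too close to a vertex of even size.  With
  two fractional coordinates \<open>i\<close> and \<open>j\<close> the point can be moved in both directions along a line in
  the plane of these coordinates: one tight corner inequality determines the line, and by
  \<open>demicube_tight_pair\<close> all other tight corner inequalities are constant along it too.
\<close>

lemma extreme_point_demicube_integral:
  fixes y :: "real ^ 'i::finite"
  assumes "y extreme_point_of demicube"
  shows "y $ i = 0 \<or> y $ i = 1"
proof (rule ccontr)
  assume contr: "\<not> (y $ i = 0 \<or> y $ i = 1)"
  have y: "y \<in> demicube" using assms by (simp add: extreme_point_of_def)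
  then have y01: "0 \<le> y $ k" "y $ k \<le> 1" for k by (auto simp: demicube_def demicube_cone_def)
  have corner: "1 \<le> (\<Sum>k\<in>UNIV. flip 1 K (($) y) k)" if "even (card K)" for K
    using y that by (auto simp: demicube_def demicube_cone_def)
  have i: "0 < y $ i" "y $ i < 1" using contr y01[of i] by auto
  obtain j where j: "j \<noteq> i" "0 < y $ j" "y $ j < 1"
  proof (rule ccontr)
    assume no: "\<not> thesis"
    have int: "y $ k = 0 \<or> y $ k = 1" if "k \<noteq> i" for k
    proof -
      have "\<not> (0 < y $ k \<and> y $ k < 1)"
        using no that \<open>\<And>j. \<lbrakk>j \<noteq> i; 0 < y $ j; y $ j < 1\<rbrakk> \<Longrightarrow> thesis\<close> by blast
      then show ?thesis using y01[of k] by linarith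
    qed
    define J where "J = {k. k \<noteq> i \<and> y $ k = 1}"
    \<comment> \<open>the nearest vertex with the right parity\<close>
    define K where "K = (if even (card J) then J else insert i J)"
    have "i \<notin> J" by (simp add: J_def)
    then have "even (card K)" by (simp add: K_def)
    have "flip 1 K (($) y) k = 0" if "k \<noteq> i" for k
      using int[OF that] that by (auto simp: flip_def K_def J_def)
    then have "(\<Sum>k\<in>UNIV. flip 1 K (($) y) k) = flip 1 K (($) y) i"
      by (subst sum.remove[of _ i]) auto
    also have "\<dots> < 1" using i by (simp add: flip_def)
    finally show False using corner[OF \<open>even (card K)\<close>] by simp
  qed
  define tight where "tight K \<longleftrightarrow> even (card K) \<and> (\<Sum>k\<in>UNIV. flip 1 K (($) y) k) = 1" for K
  \<comment> \<open>any tight corner if there is one; otherwise \<open>K\<close> is arbitrary\<close>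
  obtain K where K: "\<And>L. tight L \<Longrightarrow> tight K" by metis
  define s :: "'i set \<Rightarrow> 'i \<Rightarrow> real" where "s L k = (if k \<in> L then -1 else (1::real))" for L k
  \<comment> \<open>the direction along which the tight corner inequality stays tight\<close>
  define v where "v = (\<chi> k. if k = i then s K i else if k = j then - s K j else (0::real))"
  have flip_v: "(\<Sum>k\<in>UNIV. flip 1 L (($) (y + e *\<^sub>R v)) k)
      = (\<Sum>k\<in>UNIV. flip 1 L (($) y) k) + e * (s L i * s K i - s L j * s K j)" for L e
  proof -
    have "flip 1 L (($) (y + e *\<^sub>R v)) k = flip 1 L (($) y) k + e * (s L k * v $ k)" for k
      by (simp add: flip_def s_def)
    then have "(\<Sum>k\<in>UNIV. flip 1 L (($) (y + e *\<^sub>R v)) k)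
      = (\<Sum>k\<in>UNIV. flip 1 L (($) y) k) + e * (\<Sum>k\<in>UNIV. s L k * v $ k)"
      by (simp add: sum.distrib sum_distrib_left)
    moreover have "(\<Sum>k\<in>UNIV. s L k * v $ k) = (\<Sum>k\<in>{i, j}. s L k * v $ k)"
      by (rule sum.mono_neutral_right) (auto simp: v_def)
    moreover have "(\<Sum>k\<in>{i, j}. s L k * v $ k) = s L i * s K i - s L j * s K j"
      using j(1) by (simp add: v_def)
    ultimately show ?thesis by simp
  qed
  have tight_v: "s L i * s K i - s L j * s K j = 0" if "tight L" for L
  proof (cases "L = K")
    case False
    have "tight K" using K that .
    then have "(i \<in> L) \<noteq> (i \<in> K)" "(j \<in> L) \<noteq> (j \<in> K)"
      using demicube_tight_pair[OF y, of L K i j] that False i j by (auto simp: tight_def)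
    then show ?thesis by (auto simp: s_def)
  qed (auto simp: s_def)
  have sl: "\<bar>s L i * s K i - s L j * s K j\<bar> \<le> 2" for L by (auto simp: s_def)
  obtain e where e: "0 < e" and e_min: "\<And>x. x \<in> {y $ i, 1 - y $ i, y $ j, 1 - y $ j} \<union>
      (\<lambda>L. ((\<Sum>k\<in>UNIV. flip 1 L (($) y) k) - 1) / 2) ` {L. even (card L) \<and> \<not> tight L} \<Longrightarrow> e \<le> x"
  proof (rule positive_lower_bound)
    fix x assume "x \<in> {y $ i, 1 - y $ i, y $ j, 1 - y $ j} \<union>
      (\<lambda>L. ((\<Sum>k\<in>UNIV. flip 1 L (($) y) k) - 1) / 2) ` {L. even (card L) \<and> \<not> tight L}"
    then show "0 < x" using i j corner by (auto simp: tight_def order_less_le)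
  qed auto
  have box: "e \<le> y $ i" "e \<le> 1 - y $ i" "e \<le> y $ j" "e \<le> 1 - y $ j"
    by (auto intro: e_min)
  have in_P: "y + c *\<^sub>R v \<in> demicube" if c: "\<bar>c\<bar> = e" for c
    unfolding demicube_def demicube_cone_def mem_Collect_eq
  proof (intro conjI allI impI)
    fix k
    have "\<bar>c * v $ k\<bar> = (if k = i \<or> k = j then e else 0)"
      using c by (auto simp: v_def s_def abs_mult)
    then have "- (if k = i \<or> k = j then e else 0) \<le> c * v $ k \<and> c * v $ k \<le> (if k = i \<or> k = j then e else 0)"
      by linarith
    then show "0 \<le> (y + c *\<^sub>R v) $ k" "(y + c *\<^sub>R v) $ k \<le> 1"
      using box y01[of k] by (auto split: if_splits)
  next
    fix L :: "'i set" assume L: "even (card L)"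
    show "1 \<le> (\<Sum>k\<in>UNIV. flip 1 L (($) (y + c *\<^sub>R v)) k)"
    proof (cases "tight L")
      case True
      then show ?thesis using corner[OF L] by (simp only: flip_v tight_v)
    next
      case False
      then have "e \<le> ((\<Sum>k\<in>UNIV. flip 1 L (($) y) k) - 1) / 2" using L by (intro e_min) auto
      moreover define q where "q = c * (s L i * s K i - s L j * s K j)"
      moreover have "\<bar>q\<bar> \<le> e * 2"
        unfolding q_def abs_mult c using sl e by (intro mult_left_mono) auto
      ultimately show ?thesis unfolding flip_v by (simp flip: q_def)
    qed
  qed
  have "v $ i \<noteq> 0" by (simp add: v_def s_def)
  then have "(y - e *\<^sub>R v) $ i \<noteq> (y + e *\<^sub>R v) $ i" using e by simp
  then have ne: "y - e *\<^sub>R v \<noteq> y + e *\<^sub>R v" by metis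
  have "midpoint (y - e *\<^sub>R v) (y + e *\<^sub>R v) = y"
    by (simp add: midpoint_def scaleR_2[symmetric])
  then have "y \<in> open_segment (y - e *\<^sub>R v) (y + e *\<^sub>R v)"
    using ne midpoint_in_open_segment by metis
  moreover have "y - e *\<^sub>R v \<in> demicube" "y + e *\<^sub>R v \<in> demicube"
    using in_P[of "-e"] in_P[of e] e by auto
  ultimately show False using assms by (auto simp: extreme_point_of_def)
qed

lemma extreme_point_demicube:
  fixes y :: "real ^ 'i::finite"
  assumes "y extreme_point_of demicube"
  obtains J where "odd (card J)" "\<And>i. y $ i = of_bool (i \<in> J)"
proof -
  define J where "J = {i. y $ i = 1}"
  have yJ: "y $ i = of_bool (i \<in> J)" for i
    using extreme_point_demicube_integral[OF assms, of i] by (auto simp: J_def)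
  have "odd (card J)"
  proof
    assume "even (card J)"
    moreover have "y \<in> demicube" using assms by (simp add: extreme_point_of_def)
    ultimately have "1 \<le> (\<Sum>i\<in>UNIV. flip 1 J (($) y) i)" by (auto simp: demicube_def demicube_cone_def)
    moreover have "flip 1 J (($) y) i = 0" for i by (simp add: flip_def yJ)
    ultimately show False by simp
  qed
  then show ?thesis using that yJ by blast
qed

section \<open>The effective cone is the cone over the demicube\<close>

definition coord :: "'i::finite N1 \<Rightarrow> 'i \<Rightarrow> real" where
  "coord x i = fst x - snd x $ i"

definition height :: "'i::finite N1 \<Rightarrow> real" where
  "height x = (\<Sum>i\<in>UNIV. coord x i) - 2 * fst x"

lemma coord_class_of [simp]: "coord (class_of h y) = y"
  by (simp add: coord_def class_of_def fun_eq_iff)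

lemma height_class_of [simp]: "height (class_of h y) = h"
  by (simp add: height_def coord_class_of) (simp add: class_of_def field_simps)

lemma class_of_coord: "class_of (height x) (coord x) = x"
  by (simp add: class_of_def height_def coord_def prod_eq_iff vec_eq_iff)

lemma coord_add: "coord (x + x') i = coord x i + coord x' i"
  by (simp add: coord_def)

lemma coord_scale: "coord (c *\<^sub>R x) i = c * coord x i"
  by (simp add: coord_def algebra_simps)

lemma height_add: "height (x + x') = height x + height x'"
  by (simp add: height_def coord_add sum.distrib)

lemma height_scale: "height (c *\<^sub>R x) = c * height x"
  by (simp add: height_def coord_scale algebra_simps flip: sum_distrib_left)

lemma class_of_add: "class_of (h + h') (\<lambda>i. y i + y' i) = class_of h y + class_of h' y'"
  using class_of_coord[of "class_of h y + class_of h' y'"]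
  by (simp add: height_add coord_add[abs_def])

lemma class_of_scale: "class_of (c * h) (\<lambda>i. c * y i) = c *\<^sub>R class_of h y"
  using class_of_coord[of "c *\<^sub>R class_of h y"]
  by (simp add: height_scale coord_scale[abs_def])

lemma convex_cone_demicube_cone: "convex_cone {x. demicube_cone (height x) (coord x)}"
proof -
  have "coord (0 :: 'a N1) = (\<lambda>_. 0)" by (simp add: coord_def fun_eq_iff)
  then have "demicube_cone (height (0 :: 'a N1)) (coord (0 :: 'a N1))"
    by (simp add: demicube_cone_def height_def flip_def cong: if_cong)
  then show ?thesis
    unfolding convex_cone_iff
    using demicube_cone_add demicube_cone_mult
    by (auto simp: height_add coord_add[abs_def] height_scale coord_scale[abs_def])
qed

lemma prime_class_in_demicube_cone:
  fixes p :: "'i::finite \<Rightarrow> complex ^ 'v::finite"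
  assumes gp: "general_position p" and card: "CARD('i) = CARD('v) + 2"
    and "Z \<in> prime_divisors"
  shows "demicube_cone (height (prime_class p Z)) (coord (prime_class p Z))"
proof -
  have *: "demicube_cone (height x) (coord x)"
    if "has_section p h y" "x = class_of (of_int h) (\<lambda>i. of_int (y i))" for x h y
    using has_section_imp_demicube_cone(1)[OF gp card that(1)] demicube_cone_of_int[of h y]
    by (simp add: that(2))
  show ?thesis
  proof (cases Z)
    case (Exceptional i)
    have "has_section p 1 (\<lambda>k. of_bool (k \<in> {i}))" by (rule has_section_vertex[OF gp card]) simp
    then show ?thesis
      by (rule *) (simp add: Exceptional class_of_def vec_eq_iff axis_def)
  next
    case (Strict_Transform F)
    then obtain d where F: "homogeneous d F" "F \<noteq> 0"
      using assms(3) by (auto simp: prime_divisors_def irreducible_def)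
    have deg: "total_degree F = d" by (rule total_degree_homogeneous[OF F])
    define y where "y i = int d - int (multiplicity_at F (p i))" for i
    have "has_section p ((\<Sum>i\<in>UNIV. y i) - 2 * int d) y"
      unfolding has_section_def
      by (rule exI[of _ d], rule exI[of _ F]) (use F multiplicity_at_vanishes[OF gp card F] in \<open>simp add: y_def\<close>)
    then show ?thesis
      by (rule *) (simp add: Strict_Transform class_of_def deg y_def vec_eq_iff)
  qed
qed

theorem effective_cone_eq:
  fixes p :: "'i::finite \<Rightarrow> complex ^ 'v::finite"
  assumes gp: "general_position p" and card: "CARD('i) = CARD('v) + 2"
  shows "effective_cone p = {x. demicube_cone (height x) (coord x)}"
proof
  let ?Q = "{x :: 'i N1. demicube_cone (height x) (coord x)}"
  show "effective_cone p \<subseteq> ?Q"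
    unfolding effective_cone_def
  proof (rule hull_minimal)
    show "convex_cone ?Q" by (rule convex_cone_demicube_cone)
    show "{divisor_class p D | D. effective D} \<subseteq> ?Q"
    proof
      fix x assume "x \<in> {divisor_class p D | D. effective D}"
      then obtain D where D: "effective D" "x = divisor_class p D" by blast
      have hull: "convex_cone hull ?Q = ?Q"
        by (rule hull_same) (rule convex_cone_demicube_cone)
      have "divisor_class p D \<in> convex_cone hull ?Q"
        unfolding divisor_class_def
      proof (intro convex_cone_hull_sum convex_cone_hull_mul)
        fix Z assume "Z \<in> keys D"
        then have "Z \<in> prime_divisors" using D by (auto simp: effective_def divisors_def)
        then show "prime_class p Z \<in> convex_cone hull ?Q"
          unfolding hull using prime_class_in_demicube_cone[OF gp card] by blast
        show "0 \<le> real_of_int (lookup D Z)" using D by (simp add: effective_def)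
      qed
      then show "x \<in> ?Q"
        unfolding hull D(2) .
    qed
  qed
next
  define C where "C = {y :: real ^ 'i. class_of 1 (($) y) \<in> effective_cone p}"
  have vertex: "y \<in> C" if ext: "y extreme_point_of demicube" for y
  proof -
    obtain J where J: "odd (card J)" "\<And>i. y $ i = of_bool (i \<in> J)"
      using extreme_point_demicube[OF ext] by blast
    have "class_of (of_int 1) (\<lambda>i. of_int (of_bool (i \<in> J))) \<in> effective_cone p"
      by (rule has_section_class[OF gp card has_section_vertex[OF gp card J(1)]])
    then show ?thesis by (simp add: C_def J(2)[abs_def])
  qed
  have "convex C"
  proof (rule convexI)
    fix x y u v assume *: "x \<in> C" "y \<in> C" "0 \<le> u" "0 \<le> v" "u + v = (1::real)"
    then have "u *\<^sub>R class_of 1 (($) x) + v *\<^sub>R class_of 1 (($) y) \<in> effective_cone p"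
      unfolding C_def effective_cone_def by (intro convex_cone_hull_add convex_cone_hull_mul) auto
    moreover have "(\<lambda>i. u * x $ i + v * y $ i) = ($) (u *\<^sub>R x + v *\<^sub>R y)" by (simp add: fun_eq_iff)
    moreover from this have "u *\<^sub>R class_of 1 (($) x) + v *\<^sub>R class_of 1 (($) y) = class_of 1 (($) (u *\<^sub>R x + v *\<^sub>R y))"
      using class_of_add[of "u * 1" "v * 1" "\<lambda>i. u * x $ i" "\<lambda>i. v * y $ i"] *(5)
        class_of_scale[of u 1 "($) x"] class_of_scale[of v 1 "($) y"]
        \<open>(\<lambda>i. u * x $ i + v * y $ i) = ($) (u *\<^sub>R x + v *\<^sub>R y)\<close> by simp
    ultimately show "u *\<^sub>R x + v *\<^sub>R y \<in> C" by (simp add: C_def)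
  qed
  then have "demicube \<subseteq> C"
    using Krein_Milman_Minkowski[OF compact_demicube convex_demicube] vertex
    by (metis hull_minimal mem_Collect_eq subsetI)
  show "{x. demicube_cone (height x) (coord x)} \<subseteq> effective_cone p"
  proof
    fix x :: "'i N1" assume "x \<in> {x. demicube_cone (height x) (coord x)}"
    then have x: "demicube_cone (height x) (coord x)" by simp
    then have bd: "0 \<le> coord x i" "coord x i \<le> height x" for i by (auto simp: demicube_cone_def)
    then have "0 \<le> height x" by (meson order_trans)
    then consider "height x = 0" | "height x > 0" by linarith
    then show "x \<in> effective_cone p"
    proof cases
      case 1
      have "coord x i = 0" for i using bd[of i] 1 by linarith
      then have "coord x = (\<lambda>_. 0)" by (rule ext)
      then have "x = class_of 0 (\<lambda>_. 0)" using class_of_coord[of x] 1 by simp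
      also have "\<dots> = 0" by (simp add: class_of_def zero_prod_def vec_eq_iff)
      finally show ?thesis by (simp add: effective_cone_def convex_cone_hull_contains_0)
    next
      case 2
      define y where "y = (\<chi> i. (1 / height x) * coord x i)"
      have y: "($) y = (\<lambda>i. 1 / height x * coord x i)" by (simp add: y_def fun_eq_iff)
      have "demicube_cone (1 / height x * height x) (\<lambda>i. 1 / height x * coord x i)"
        by (rule demicube_cone_mult[OF x]) (use 2 in simp)
      then have "y \<in> demicube" using 2 by (simp add: demicube_def y)
      then have "class_of 1 (($) y) \<in> effective_cone p" using \<open>demicube \<subseteq> C\<close> by (auto simp: C_def)
      then have "height x *\<^sub>R class_of 1 (($) y) \<in> effective_cone p"
        using 2 unfolding effective_cone_def by (intro convex_cone_hull_mul) auto
      moreover have "height x *\<^sub>R class_of 1 (($) y) = x"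
        using class_of_scale[of "height x" 1 "($) y"] 2 by (simp add: y class_of_coord)
      ultimately show ?thesis by simp
    qed
  qed
qed

section \<open>Facets\<close>

text \<open>
  The point \<open>c\<close> makes the cone full-dimensional, and \<open>w k\<close> shows that the inequality \<open>k\<close> cannot
  be dropped; in an irredundant system every inequality defines a facet.
\<close>

lemma facets_of_irredundant_cone:
  fixes f :: "'k \<Rightarrow> 'a::euclidean_space \<Rightarrow> real"
  assumes "finite X" and lin: "\<And>k. k \<in> X \<Longrightarrow> linear (f k)"
    and inner: "\<And>k. k \<in> X \<Longrightarrow> f k c < 0"
    and wit: "\<And>k. k \<in> X \<Longrightarrow> 0 < f k (w k)" "\<And>k k'. k \<in> X \<Longrightarrow> k' \<in> X \<Longrightarrow> k' \<noteq> k \<Longrightarrow> f k' (w k) \<le> 0"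
    and S: "S = {x. \<forall>k\<in>X. f k x \<le> 0}"
  shows "\<Phi> facet_of S \<longleftrightarrow> (\<exists>k\<in>X. \<Phi> = S \<inter> {x. f k x = 0})"
proof -
  define half where "half k = {x. f k x \<le> 0}" for k
  define \<alpha> where "\<alpha> k = adjoint (f k) 1" for k
  have \<alpha>: "\<alpha> k \<bullet> x = f k x" if "k \<in> X" for k x
    using adjoint_works[OF lin[OF that], of x 1] by (simp add: \<alpha>_def inner_commute)
  have inj: "inj_on half X"
  proof (rule inj_onI, rule ccontr)
    fix k k' assume *: "k \<in> X" "k' \<in> X" "half k = half k'" "k \<noteq> k'"
    then have "w k \<in> half k'" using wit(2) by (auto simp: half_def)
    then show False using wit(1)[OF *(1)] by (simp flip: *(3)) (simp add: half_def)
  qed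
  have S_half: "S = \<Inter> (half ` X)" by (auto simp: S half_def)
  define U where "U = (\<Inter>k\<in>X. {x. \<alpha> k \<bullet> x < 0})"
  have "open U" unfolding U_def using \<open>finite X\<close> by (auto intro!: open_INT open_halfspace_lt)
  moreover have "c \<in> U" using inner by (auto simp: U_def \<alpha>)
  moreover have "U \<subseteq> S" by (auto simp: U_def S \<alpha> intro: less_imp_le)
  ultimately have "interior S \<noteq> {}" using interior_maximal[of U S] by auto
  then have aff: "affine hull S = UNIV" by (rule affine_hull_nonempty_interior)
  have "\<Phi> facet_of S \<longleftrightarrow> (\<exists>h. h \<in> half ` X \<and> \<Phi> = S \<inter> {x. \<alpha> (inv_into X half h) \<bullet> x = 0})"
  proof (rule facet_of_polyhedron_explicit)
    show "finite (half ` X)" using \<open>finite X\<close> by simp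
    show "S = affine hull S \<inter> \<Inter> (half ` X)" unfolding aff using S_half by simp
  next
    fix h assume "h \<in> half ` X"
    then obtain k where k: "k \<in> X" "h = half k" by blast
    have "\<alpha> k \<noteq> 0" using wit(1)[OF k(1)] \<alpha>[OF k(1), of "w k"] by auto
    then show "\<alpha> (inv_into X half h) \<noteq> 0 \<and> h = {x. \<alpha> (inv_into X half h) \<bullet> x \<le> 0}"
      using k inj by (simp add: inv_into_f_f \<alpha>) (simp add: half_def)
  next
    fix F' assume F': "F' \<subset> half ` X"
    then obtain k where k: "k \<in> X" "half k \<notin> F'" by blast
    have "w k \<in> \<Inter> F'"
    proof
      fix h assume "h \<in> F'"
      then obtain k' where "k' \<in> X" "h = half k'" "k' \<noteq> k" using F' k by blast
      then show "w k \<in> h" using wit(2)[OF k(1)] by (simp add: half_def)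
    qed
    moreover have "w k \<notin> S" using wit(1)[OF k(1)] k(1) by (force simp: S)
    moreover have "S \<subseteq> \<Inter> F'" using F' S_half by blast
    ultimately show "S \<subset> affine hull S \<inter> \<Inter> F'" by (auto simp: aff)
  qed
  also have "\<dots> \<longleftrightarrow> (\<exists>k\<in>X. \<Phi> = S \<inter> {x. f k x = 0})"
    using inj by (auto simp: inv_into_f_f \<alpha>)
  finally show ?thesis .
qed

datatype 'i demicube_facet = Lower 'i | Upper 'i | Corner "'i set"

fun excess :: "'i::finite demicube_facet \<Rightarrow> 'i N1 \<Rightarrow> real" where
  "excess (Lower i) x = - coord x i"
| "excess (Upper i) x = coord x i - height x"
| "excess (Corner K) x = height x - (\<Sum>i\<in>UNIV. flip (height x) K (coord x) i)"

lemma linear_excess: "linear (excess k)"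
proof (rule linearI; cases k)
  fix x y :: "'a N1" and K assume "k = Corner K"
  then show "excess k (x + y) = excess k x + excess k y"
    by (simp add: height_add coord_add[abs_def] flip_add sum.distrib)
next
  fix c and x :: "'a N1" and K assume "k = Corner K"
  then show "excess k (c *\<^sub>R x) = c *\<^sub>R excess k x"
    by (simp add: height_scale coord_scale[abs_def] flip_mult right_diff_distrib flip: sum_distrib_left)
qed (simp_all add: coord_add coord_scale height_add height_scale algebra_simps)

definition demicube_facets :: "'i::finite demicube_facet set" where
  "demicube_facets = range Lower \<union> range Upper \<union> Corner ` {K. even (card K)}"

lemma demicube_cone_excess:
  "demicube_cone (height x) (coord x) \<longleftrightarrow> (\<forall>k\<in>demicube_facets. excess k x \<le> 0)"
  unfolding demicube_cone_def demicube_facets_def by (simp add: ball_Un) auto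

text \<open>
  Moving one coordinate of the centre of the cube beyond a wall keeps all corner inequalities, since in
  dimension at least 5 four other coordinates stay in the middle.  A vertex of even size violates its own corner
  inequality and no other.
\<close>

fun violator :: "'i::finite demicube_facet \<Rightarrow> 'i \<Rightarrow> real" where
  "violator (Lower i) = (\<lambda>_. 1 / 2)(i := - 1 / 2)"
| "violator (Upper i) = (\<lambda>_. 1 / 2)(i := 3 / 2)"
| "violator (Corner K) = (\<lambda>i. of_bool (i \<in> K))"

lemma sum_flip_half:
  fixes z :: real
  assumes "CARD('i::finite) \<ge> 5" "- 1 / 2 \<le> z" "z \<le> 3 / 2"
  shows "1 \<le> (\<Sum>k\<in>UNIV. flip 1 K ((\<lambda>_. 1 / 2)(i := z)) (k :: 'i))"
proof -
  have "(\<Sum>k\<in>UNIV. flip 1 K ((\<lambda>_. 1 / 2)(i := z)) k)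
      = flip 1 K ((\<lambda>_. 1 / 2)(i := z)) i + (\<Sum>k\<in>UNIV - {i}. 1 / 2)"
  proof -
    have "(\<Sum>k\<in>UNIV - {i}. flip 1 K ((\<lambda>_. 1 / 2)(i := z)) k) = (\<Sum>k\<in>UNIV - {i}. 1 / 2)"
      by (rule sum.cong) (auto simp: flip_def)
    then show ?thesis by (simp only: sum.remove[OF finite UNIV_I, of _ i])
  qed
  moreover have "flip 1 K ((\<lambda>_. 1 / 2)(i := z)) i \<ge> - 1 / 2" using assms by (simp add: flip_def)
  moreover have "(\<Sum>k\<in>UNIV - {i}. 1 / 2 :: real) \<ge> 2"
    using assms(1) by (simp add: card_Diff_singleton of_nat_diff)
  ultimately show ?thesis by linarith
qed

lemma excess_violator_pos: "0 < excess k (class_of 1 (violator k))"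
proof (cases k)
  case (Corner K)
  have "flip 1 K (\<lambda>i. of_bool (i \<in> K)) = (\<lambda>_. 0 :: real)" by (simp add: flip_def fun_eq_iff)
  then show ?thesis using Corner by simp
qed auto

lemma excess_violator_other:
  fixes k k' :: "'i::finite demicube_facet"
  assumes "CARD('i) \<ge> 5" "k' \<noteq> k"
  shows "excess k' (class_of 1 (violator k)) \<le> 0"
proof (cases k)
  case (Lower i)
  then show ?thesis using assms sum_flip_half[OF assms(1), of "- 1 / 2" _ i] by (cases k') auto
next
  case (Upper i)
  then show ?thesis using assms sum_flip_half[OF assms(1), of "3 / 2" _ i] by (cases k') auto
next
  case (Corner K)
  show ?thesis
  proof (cases k')
    case (Corner K')
    with \<open>k = Corner K\<close> assms(2) obtain i where i: "(i \<in> K') \<noteq> (i \<in> K)" by auto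
    have "flip 1 K' (\<lambda>i. of_bool (i \<in> K)) i \<le> (\<Sum>i\<in>UNIV. flip 1 K' (\<lambda>i. of_bool (i \<in> K) :: real) i)"
      by (rule member_le_sum) (auto simp: flip_def)
    moreover have "flip 1 K' (\<lambda>i. of_bool (i \<in> K)) i = (1 :: real)" using i by (auto simp: flip_def)
    ultimately show ?thesis using Corner \<open>k = Corner K\<close> by simp
  qed (use Corner in auto)
qed

lemma facets_of_demicube_cone:
  fixes S :: "'i::finite N1 set"
  assumes "CARD('i) \<ge> 5" and S: "S = {x. demicube_cone (height x) (coord x)}"
  shows "{\<Phi>. \<Phi> facet_of S} = {S \<inter> {x. excess k x = 0} | k. k \<in> demicube_facets}"
proof -
  have "finite (demicube_facets :: 'i demicube_facet set)" by (simp add: demicube_facets_def)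
  moreover have "excess k (class_of 1 (\<lambda>_. 1 / 2)) < 0" for k :: "'i demicube_facet"
  proof (cases k)
    case (Corner K)
    have "flip 1 K (\<lambda>_. 1 / 2) = (\<lambda>_. 1 / 2 :: real)" by (simp add: flip_def fun_eq_iff)
    then show ?thesis using Corner assms(1) by simp
  qed auto
  ultimately have "\<Phi> facet_of S \<longleftrightarrow> (\<exists>k\<in>demicube_facets. \<Phi> = S \<inter> {x. excess k x = 0})" for \<Phi>
    using excess_violator_other[OF assms(1)]
    by (intro facets_of_irredundant_cone[where c = "class_of 1 (\<lambda>_. 1 / 2)" and w = "\<lambda>k. class_of 1 (violator k)"])
       (auto simp: linear_excess excess_violator_pos S demicube_cone_excess)
  then show ?thesis by blast
qed

section \<open>The inequalities in the original coordinates\<close>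

lemma height_eq:
  fixes m :: "real ^ 'i::finite"
  assumes "CARD('i) = n + 3"
  shows "height (d, m) = (real n + 1) * d - (\<Sum>i\<in>UNIV. m $ i)"
  by (simp add: height_def coord_def sum_subtractf assms algebra_simps)

text \<open>
  The set \<open>- I\<close> has \<open>2 t + 2\<close> elements, so \<open>t\<close> can be recovered from the corner alone.
\<close>

lemma excess_Corner_eq:
  fixes m :: "real ^ 'i::finite"
  assumes card: "CARD('i) = n + 3" and I: "int (card I) = int n - 2 * t + 1"
  shows "excess (Corner (- I)) (d, m) = 2 * k_sigma n d m I t"
proof -
  define h where "h = height (d, m)"
  have "int (card (- I)) = 2 * t + 2"
    using I card card_mono[of UNIV I] by (simp add: Compl_eq_Diff_UNIV card_Diff_subset of_nat_diff)
  then have cK: "real (card (- I)) = 2 * of_int t + 2" by linarith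
  have cI: "real (card I) = real n - 2 * of_int t + 1" using I by linarith
  have "flip h (- I) (coord (d, m)) i = (if i \<in> - I then h else 0) + (if i \<in> I then d - m $ i else - (d - m $ i))" for i
    by (simp add: flip_def coord_def)
  then have "(\<Sum>i\<in>UNIV. flip h (- I) (coord (d, m)) i)
      = (\<Sum>i\<in>UNIV. if i \<in> - I then h else 0) + (\<Sum>i\<in>UNIV. if i \<in> I then d - m $ i else - (d - m $ i))"
    by (simp add: sum.distrib)
  also have "(\<Sum>i\<in>UNIV. if i \<in> - I then h else 0) = real (card (- I)) * h"
    by (subst sum.inter_restrict[symmetric]) auto
  also have "(\<Sum>i\<in>UNIV. if i \<in> I then d - m $ i else - (d - m $ i))
      = (\<Sum>i\<in>UNIV. 2 * (if i \<in> I then d - m $ i else 0) - (d - m $ i))"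
    by (rule sum.cong) auto
  also have "\<dots> = 2 * (\<Sum>i\<in>I. d - m $ i) - (\<Sum>i\<in>UNIV. d - m $ i)"
    by (simp add: sum_subtractf sum.If_cases flip: sum_distrib_left)
  also have "\<dots> = 2 * (real (card I) * d - (\<Sum>i\<in>I. m $ i)) - ((real n + 3) * d - (\<Sum>i\<in>UNIV. m $ i))"
    by (simp add: sum_subtractf card)
  finally have "(\<Sum>i\<in>UNIV. flip h (- I) (coord (d, m)) i) = real (card (- I)) * h +
      (2 * (real (card I) * d - (\<Sum>i\<in>I. m $ i)) - ((real n + 3) * d - (\<Sum>i\<in>UNIV. m $ i)))" .
  then show ?thesis
    unfolding excess.simps h_def[symmetric]
    by (simp add: cK cI k_sigma_def) (simp add: h_def height_eq[OF card] algebra_simps)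
qed

lemma excess_Lower_Upper:
  fixes m :: "real ^ 'i::finite"
  assumes "CARD('i) = n + 3"
  shows "excess (Lower i) (d, m) = m $ i - d"
    "excess (Upper i) (d, m) = (\<Sum>j\<in>UNIV. m $ j) - m $ i - real n * d"
  by (simp_all add: coord_def height_eq[OF assms] algebra_simps)

text \<open>
  The range of \<open>t\<close> is exactly the one in which \<open>2 t + 2\<close> runs through the even numbers from 0
  to n + 3.
\<close>

lemma corners_iff:
  assumes card: "CARD('i::finite) = n + 3" and n: "n = 2 * l + \<epsilon>" "\<epsilon> \<in> {0, 1::nat}"
  shows "even (card (K :: 'i set)) \<longleftrightarrow>
    (\<exists>t::int. -1 \<le> t \<and> t \<le> int (l + \<epsilon>) \<and> int (card (- K)) = int n - 2 * t + 1)"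
proof
  have le: "card K \<le> n + 3" and c: "int (card (- K)) = int n + 3 - int (card K)"
    using card_mono[of UNIV K] card by (auto simp: Compl_eq_Diff_UNIV card_Diff_subset of_nat_diff)
  show "\<exists>t::int. -1 \<le> t \<and> t \<le> int (l + \<epsilon>) \<and> int (card (- K)) = int n - 2 * t + 1" if "even (card K)"
  proof -
    obtain s where s: "card K = 2 * s" using \<open>even (card K)\<close> by (auto elim: evenE)
    show ?thesis
      by (rule exI[of _ "int s - 1"]) (use s c le n in auto)
  qed
  show "even (card K)" if "\<exists>t::int. -1 \<le> t \<and> t \<le> int (l + \<epsilon>) \<and> int (card (- K)) = int n - 2 * t + 1"
    using that c by presburger
qed

lemma conditions_iff_demicube_cone:
  fixes m :: "real ^ 'i::finite"
  assumes card: "CARD('i) = n + 3" and n: "n = 2 * l + \<epsilon>" "\<epsilon> \<in> {0, 1::nat}"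
  shows "cond_A d m \<and> cond_B n d m \<and> (\<forall>t::int. -1 \<le> t \<and> t \<le> int (l + \<epsilon>) \<longrightarrow> cond_C n t d m)
    \<longleftrightarrow> demicube_cone (height (d, m)) (coord (d, m))"
proof -
  have "cond_A d m \<longleftrightarrow> (\<forall>i. excess (Lower i) (d, m) \<le> 0)"
    unfolding cond_A_def excess_Lower_Upper[OF card] by simp
  moreover have "cond_B n d m \<longleftrightarrow> (\<forall>i. excess (Upper i) (d, m) \<le> 0)"
    unfolding cond_B_def excess_Lower_Upper[OF card] by simp
  moreover have "(\<forall>t::int. -1 \<le> t \<and> t \<le> int (l + \<epsilon>) \<longrightarrow> cond_C n t d m)
      \<longleftrightarrow> (\<forall>K. even (card K) \<longrightarrow> excess (Corner K) (d, m) \<le> 0)"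
  proof
    assume C: "\<forall>t::int. -1 \<le> t \<and> t \<le> int (l + \<epsilon>) \<longrightarrow> cond_C n t d m"
    show "\<forall>K. even (card K) \<longrightarrow> excess (Corner K) (d, m) \<le> 0"
    proof (intro allI impI)
      fix K :: "'i set" assume "even (card K)"
      then obtain t :: int where t: "-1 \<le> t" "t \<le> int (l + \<epsilon>)" "int (card (- K)) = int n - 2 * t + 1"
        using corners_iff[OF card n] by blast
      then have "k_sigma n d m (- K) t \<le> 0" using C by (auto simp: cond_C_def)
      then show "excess (Corner K) (d, m) \<le> 0" using excess_Corner_eq[OF card t(3), of d m] by (simp del: excess.simps)
    qed
  next
    assume K: "\<forall>K. even (card K) \<longrightarrow> excess (Corner K) (d, m) \<le> 0"
    show "\<forall>t::int. -1 \<le> t \<and> t \<le> int (l + \<epsilon>) \<longrightarrow> cond_C n t d m"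
      unfolding cond_C_def
    proof (intro allI impI)
      fix t :: int and I :: "'i set"
      assume *: "-1 \<le> t \<and> t \<le> int (l + \<epsilon>)" "int (card I) = int n - 2 * t + 1"
      then have "even (card (- I))" using corners_iff[OF card n, of "- I"] by auto
      then show "k_sigma n d m I t \<le> 0" using K excess_Corner_eq[OF card *(2), of d m] by (auto simp del: excess.simps)
    qed
  qed
  ultimately show ?thesis
    unfolding demicube_cone_excess demicube_facets_def ball_Un ball_simps by (auto simp del: excess.simps)
qed

lemma linear_system_nonempty_iff:
  fixes p :: "'i::finite \<Rightarrow> complex ^ 'v::finite" and m :: "'i \<Rightarrow> nat"
  assumes gp: "general_position p" and card: "CARD('i) = CARD('v) + 2"
  shows "linear_system_nonempty p d m \<longleftrightarrow>
    demicube_cone (height (real d, \<chi> i. real (m i))) (coord (real d, \<chi> i. real (m i)))"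
proof -
  define y where "y i = int d - int (m i)" for i
  define h where "h = (\<Sum>i\<in>UNIV. y i) - 2 * int d"
  have "coord (real d, \<chi> i. real (m i)) = (\<lambda>i. of_int (y i))" by (simp add: coord_def y_def fun_eq_iff)
  moreover from this have "height (real d, \<chi> i. real (m i)) = of_int h" by (simp add: height_def h_def)
  ultimately have "demicube_cone (height (real d, \<chi> i. real (m i))) (coord (real d, \<chi> i. real (m i)))
      \<longleftrightarrow> demicube_cone h y" by (simp add: demicube_cone_of_int)
  also have "\<dots> \<longleftrightarrow> has_section p h y" by (simp add: has_section_iff[OF gp card] h_def)
  also have "\<dots> \<longleftrightarrow> linear_system_nonempty p d m"
  proof -
    have "2 * int d' = (\<Sum>i\<in>UNIV. y i) - h \<longleftrightarrow> d' = d" for d' by (auto simp: h_def)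
    moreover have "nat (int d - y i) = m i" for i by (simp add: y_def)
    ultimately show ?thesis
      by (auto simp: has_section_def linear_system_nonempty_def linear_system_def)
  qed
  finally show ?thesis by simp
qed

theorem theorem5p1:
  fixes p :: "'i::finite \<Rightarrow> complex ^ 'v::finite" and n l \<epsilon> :: nat
  assumes "n \<ge> 2" and "n = 2 * l + \<epsilon>" and "\<epsilon> \<in> {0, 1}"
    and "CARD('v) = n + 1" and "CARD('i) = n + 3"
    and "general_position p"
  shows "(\<forall>(d::nat) (m::'i \<Rightarrow> nat).
            linear_system_nonempty p d m \<longleftrightarrow>
              cond_A (real d) (\<chi> i. real (m i)) \<and>
              cond_B n (real d) (\<chi> i. real (m i)) \<and>
              (\<forall>t::int. 1 \<le> t \<and> t \<le> int (l + \<epsilon>) \<longrightarrow> cond_C n t (real d) (\<chi> i. real (m i))))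
       \<and> effective_cone p =
           {(d, m). cond_A d m \<and> cond_B n d m \<and>
              (\<forall>t::int. -1 \<le> t \<and> t \<le> int (l + \<epsilon>) \<longrightarrow> cond_C n t d m)}
       \<and> {\<Phi>. \<Phi> facet_of effective_cone p} =
           {effective_cone p \<inter> {(d, m). m $ i = d} | i. True}
           \<union> {effective_cone p \<inter> {(d, m). (\<Sum>j\<in>UNIV. m $ j) - m $ i = real n * d} | i. True}
           \<union> {effective_cone p \<inter> {(d, m). k_sigma n d m I t = 0} | (I::'i set) (t::int).
                -1 \<le> t \<and> t \<le> int (l + \<epsilon>) \<and> int (card I) = int n - 2 * t + 1}"
proof (intro conjI allI)
  note gp = \<open>general_position p\<close> and n = assms(2,3)
  have card: "CARD('i) = CARD('v) + 2" and card_n: "CARD('i) = n + 3" using assms(4,5) by auto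
  note conditions_iff = conditions_iff_demicube_cone[OF card_n n]
  \<comment> \<open>for nonnegative multiplicities \<open>t = -1\<close> says \<open>0 \<le> d\<close>, and \<open>t = 0\<close> follows from (B)\<close>
  have C_minus_1_0: "cond_C n t (real d) (\<chi> i. real (m i))"
    if B: "cond_B n (real d) (\<chi> i. real (m i))" and t: "t = -1 \<or> t = 0" for d t and m :: "'i \<Rightarrow> nat"
    unfolding cond_C_def
  proof (intro allI impI)
    fix I :: "'i set" assume I: "int (card I) = int n - 2 * t + 1"
    from t show "k_sigma n (real d) (\<chi> i. real (m i)) I t \<le> 0"
    proof
      assume t: "t = -1"
      then have "card I = CARD('i)" using I card_n by simp
      then have "I = UNIV" by (metis card_subset_eq finite subset_UNIV)
      then show ?thesis by (simp add: k_sigma_def t card_n)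
    next
      assume t: "t = 0"
      then have "card I \<noteq> CARD('i)" "real (card I) = real n + 1" using I card_n by auto
      then have "I \<noteq> UNIV" by blast
      then obtain i where i: "i \<notin> I" by blast
      have "(\<Sum>j\<in>I. real (m j)) \<le> (\<Sum>j\<in>UNIV - {i}. real (m j))" using i by (intro sum_mono2) auto
      also have "\<dots> = (\<Sum>j\<in>UNIV. real (m j)) - real (m i)" by (simp add: sum_diff1)
      also have "\<dots> \<le> real n * real d" using B by (simp add: cond_B_def)
      finally show ?thesis using \<open>real (card I) = real n + 1\<close> by (simp add: k_sigma_def t)
    qed
  qed
  show "linear_system_nonempty p d m \<longleftrightarrow>
      cond_A (real d) (\<chi> i. real (m i)) \<and> cond_B n (real d) (\<chi> i. real (m i)) \<and>
      (\<forall>t::int. 1 \<le> t \<and> t \<le> int (l + \<epsilon>) \<longrightarrow> cond_C n t (real d) (\<chi> i. real (m i)))" for d m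
    unfolding linear_system_nonempty_iff[OF gp card] conditions_iff[symmetric]
  proof (intro conj_cong refl iffI allI impI)
    fix t :: int
    assume B: "cond_B n (real d) (\<chi> i. real (m i))" and t: "-1 \<le> t \<and> t \<le> int (l + \<epsilon>)"
      and C: "\<forall>t::int. 1 \<le> t \<and> t \<le> int (l + \<epsilon>) \<longrightarrow> cond_C n t (real d) (\<chi> i. real (m i))"
    from t consider "t = -1 \<or> t = 0" | "1 \<le> t" by linarith
    then show "cond_C n t (real d) (\<chi> i. real (m i))"
      using C_minus_1_0[OF B] C t by cases blast+
  qed auto
  show "effective_cone p = {(d, m). cond_A d m \<and> cond_B n d m \<and>
      (\<forall>t::int. -1 \<le> t \<and> t \<le> int (l + \<epsilon>) \<longrightarrow> cond_C n t d m)}"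
    unfolding conditions_iff effective_cone_eq[OF gp card] by auto
  have "CARD('i) \<ge> 5" using card_n \<open>n \<ge> 2\<close> by simp
  from facets_of_demicube_cone[OF this effective_cone_eq[OF gp card]]
  have facets: "{\<Phi>. \<Phi> facet_of effective_cone p} =
      {effective_cone p \<inter> {x. excess (Lower i) x = 0} | i. True} \<union>
      {effective_cone p \<inter> {x. excess (Upper i) x = 0} | i. True} \<union>
      {effective_cone p \<inter> {x. excess (Corner K) x = 0} | K. even (card K)}"
    by (auto simp: demicube_facets_def simp del: excess.simps)
  have lower: "{x. excess (Lower i) x = 0} = {(d, m). m $ i = d}" for i :: 'i
    using excess_Lower_Upper(1)[OF card_n, of i] by (auto simp del: excess.simps)
  have upper: "{x. excess (Upper i) x = 0} = {(d, m). (\<Sum>j\<in>UNIV. m $ j) - m $ i = real n * d}" for i :: 'i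
    using excess_Lower_Upper(2)[OF card_n, of i] by (auto simp del: excess.simps)
  have corner: "{x. excess (Corner (- I)) x = 0} = {(d, m). k_sigma n d m I t = 0}"
    if "int (card I) = int n - 2 * t + 1" for I :: "'i set" and t
    using excess_Corner_eq[OF card_n that] by (auto simp del: excess.simps)
  have corners: "{effective_cone p \<inter> {x. excess (Corner K) x = 0} | K. even (card K)} =
      {effective_cone p \<inter> {(d, m). k_sigma n d m I t = 0} | (I::'i set) (t::int).
        -1 \<le> t \<and> t \<le> int (l + \<epsilon>) \<and> int (card I) = int n - 2 * t + 1}" (is "?L = ?R")
  proof
    show "?L \<subseteq> ?R"
    proof
      fix \<Phi> assume "\<Phi> \<in> ?L"
      then obtain K where K: "even (card K)" "\<Phi> = effective_cone p \<inter> {x. excess (Corner K) x = 0}" by blast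
      then obtain t :: int where t: "-1 \<le> t" "t \<le> int (l + \<epsilon>)" "int (card (- K)) = int n - 2 * t + 1"
        using corners_iff[OF card_n n] by blast
      then show "\<Phi> \<in> ?R" using K(2) corner[OF t(3)] by auto
    qed
    show "?R \<subseteq> ?L"
    proof
      fix \<Phi> assume "\<Phi> \<in> ?R"
      then obtain I :: "'i set" and t :: int where
        It: "\<Phi> = effective_cone p \<inter> {(d, m). k_sigma n d m I t = 0}"
          "-1 \<le> t" "t \<le> int (l + \<epsilon>)" "int (card I) = int n - 2 * t + 1" by blast
      then have "even (card (- I))" using corners_iff[OF card_n n, of "- I"] by auto
      then show "\<Phi> \<in> ?L" using It(1) corner[OF It(4)] by blast
    qed
  qed
  show "{\<Phi>. \<Phi> facet_of effective_cone p} =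
           {effective_cone p \<inter> {(d, m). m $ i = d} | i. True}
           \<union> {effective_cone p \<inter> {(d, m). (\<Sum>j\<in>UNIV. m $ j) - m $ i = real n * d} | i. True}
           \<union> {effective_cone p \<inter> {(d, m). k_sigma n d m I t = 0} | (I::'i set) (t::int).
                -1 \<le> t \<and> t \<le> int (l + \<epsilon>) \<and> int (card I) = int n - 2 * t + 1}"
    unfolding facets lower upper corners ..
qed

end
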